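(* Let $\mathbb{F}$ be an algebraically closed field of characteristic zero, let $\mathcal{A}$ be a two-dimensional $\mathbb{F}$-algebra with a non-trivial automorphism group and let $m>0$. Then the Artin–Procesi–Iltyakov Equality $I_m(\mathcal{A})=\mathrm{Tr}(\mathcal{A})_m$ holds for $\mathcal{A}^m$ if and only if none of the following holds: - $m>1$ and $\mathcal{A}$ is isomorphic to $\mathbf{A}_1(\alpha)$ for some $\alpha\in\mathbb{F}$; - $m>1$ and $\mathcal{A}$ is isomorphic to $\mathbf{A}_2$; - $\mathcal{A}$ is isomorphic to $\mathbf{D}_2(-1,-1)$.
   Context: An algebra is a vector space with a bilinear multiplication, not necessarily associative. For an $n$-dimensional algebra $\mathcal{A}$ over $\mathbb{F}$ with a fixed basis, $\mathbb{F}[\mathcal{A}^m]=\mathbb{F}[x_{ri}:1\leqslant r\leqslant m,1\leqslant i\leqslant n]$ is the algebra of polynomial functions on $\mathcal{A}^m$, where $x_{ri}(a_1,\ldots,a_m)$ is the $i$-th coordinate of $a_r$. The group $\mathrm{Aut}(\mathcal{A})$ of algebra automorphisms acts diagonally on $\mathcal{A}^m$ and $I_m(\mathcal{A})=\{f\in\mathbb{F}[\mathcal{A}^m]: f(g\cdot\underline{a})=f(\underline{a})\ \text{for all } g\in\mathrm{Aut}(\mathcal{A}),\ \underline{a}\in\mathcal{A}^m\}$. Operator traces: let $\mathbb{F}\langle\chi_0,\ldots,\chi_m\rangle$ be the absolutely free (non-associative) unital algebra in letters $\chi_0,\ldots,\chi_m$. If $h\in\mathbb{F}\langle\chi_0,\ldots,\chi_m\rangle$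 is homogeneous of degree $1$ in $\chi_0$ (each monomial of $h$ contains $\chi_0$ exactly once), then for $\underline{a}=(a_1,\ldots,a_m)\in\mathcal{A}^m$ let $h(\,\cdot\,,\underline{a}):\mathcal{A}\to\mathcal{A}$ be the linear operator $b\mapsto h(b,a_1,\ldots,a_m)$ (substitute $\chi_0\to b$, $\chi_r\to a_r$). The operator trace $\mathrm{tr}(h):\mathcal{A}^m\to\mathbb{F}$ is $\mathrm{tr}(h)(\underline{a})=\mathrm{tr}(h(\,\cdot\,,\underline{a}))$; it lies in $I_m(\mathcal{A})$. $\mathrm{Tr}(\mathcal{A})_m$ is the subalgebra of $I_m(\mathcal{A})$ generated by $1$ and all operator traces $\mathrm{tr}(h)$. The algebras named in the statement have basis $e_1,e_2$ and products $(e_1e_1,\;e_1e_2,\;e_2e_1,\;e_2e_2)$: $\mathbf{A}_1(\alpha)$: $(e_1+e_2,\;\alpha e_2,\;(1-\alpha)e_2,\;0)$; $\mathbf{A}_2$: $(e_2,\;e_2,\;-e_2,\;0)$; $\mathbf{D}_2(-1,-1)$: $(e_1,\;-e_2,\;-e_2,\;0)$. *)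

theory Defs
  imports "HOL-Analysis.Analysis" "HOL-Library.Poly_Mapping"
begin

section \<open>Finite-dimensional non-associative algebras\<close>

text \<open>
  The vector space is the whole type \<open>'v\<close>, with scalar multiplication \<open>scl\<close> and a fixed
  basis \<open>B\<close>. Nothing but bilinearity is required of the multiplication.
\<close>

locale nonassoc_algebra = finite_dimensional_vector_space scl B
  for scl :: "'a::field \<Rightarrow> 'v::ab_group_add \<Rightarrow> 'v" and B :: "'v set" +
  fixes mul :: "'v \<Rightarrow> 'v \<Rightarrow> 'v"
  assumes linear_mult_right: "Vector_Spaces.linear scl scl (\<lambda>y. mul x y)"
    and linear_mult_left: "Vector_Spaces.linear scl scl (\<lambda>x. mul x y)"

definition algebra_iso ::
  "('a::field \<Rightarrow> 'v::ab_group_add \<Rightarrow> 'v) \<Rightarrow> ('v \<Rightarrow> 'v \<Rightarrow> 'v) \<Rightarrow>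
   ('a \<Rightarrow> 'w::ab_group_add \<Rightarrow> 'w) \<Rightarrow> ('w \<Rightarrow> 'w \<Rightarrow> 'w) \<Rightarrow> ('v \<Rightarrow> 'w) \<Rightarrow> bool" where
  "algebra_iso scl mul scl' mul' \<phi> \<longleftrightarrow>
     Vector_Spaces.linear scl scl' \<phi> \<and> bij \<phi> \<and>
     (\<forall>x y. \<phi> (mul x y) = mul' (\<phi> x) (\<phi> y))"

definition algebra_isomorphic ::
  "('a::field \<Rightarrow> 'v::ab_group_add \<Rightarrow> 'v) \<Rightarrow> ('v \<Rightarrow> 'v \<Rightarrow> 'v) \<Rightarrow>
   ('a \<Rightarrow> 'w::ab_group_add \<Rightarrow> 'w) \<Rightarrow> ('w \<Rightarrow> 'w \<Rightarrow> 'w) \<Rightarrow> bool" where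
  "algebra_isomorphic scl mul scl' mul' \<longleftrightarrow> (\<exists>\<phi>. algebra_iso scl mul scl' mul' \<phi>)"

definition Aut :: "('a::field \<Rightarrow> 'v::ab_group_add \<Rightarrow> 'v) \<Rightarrow> ('v \<Rightarrow> 'v \<Rightarrow> 'v) \<Rightarrow> ('v \<Rightarrow> 'v) set" where
  "Aut scl mul = {g. algebra_iso scl mul scl mul g}"


section \<open>Polynomial functions and invariants\<close>

inductive_set generated_subalgebra :: "('x \<Rightarrow> 'a::field) set \<Rightarrow> ('x \<Rightarrow> 'a) set"
  for G :: "('x \<Rightarrow> 'a) set" where
  one: "(\<lambda>_. 1) \<in> generated_subalgebra G"
| gen: "f \<in> G \<Longrightarrow> f \<in> generated_subalgebra G"
| add: "f \<in> generated_subalgebra G \<Longrightarrow> g \<in> generated_subalgebra G \<Longrightarrow>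
    (\<lambda>x. f x + g x) \<in> generated_subalgebra G"
| scale: "f \<in> generated_subalgebra G \<Longrightarrow> (\<lambda>x. c * f x) \<in> generated_subalgebra G"
| mult: "f \<in> generated_subalgebra G \<Longrightarrow> g \<in> generated_subalgebra G \<Longrightarrow>
    (\<lambda>x. f x * g x) \<in> generated_subalgebra G"

text \<open>
  A point \<open>(a\<^sub>1, \<dots>, a\<^sub>m)\<close> of the \<open>m\<close>-th power of the algebra is given by a sequence
  \<open>a :: nat \<Rightarrow> 'v\<close> of which only the entries \<open>a 1, \<dots>, a m\<close> matter: all functions below are
  built from these entries only, so they are equal as functions of sequences iff they are
  equal as functions of \<open>m\<close>-tuples. The coordinates of a vector are indexed by the
  elements of the basis.
\<close>

definition coordinate ::
  "('a::field \<Rightarrow> 'v::ab_group_add \<Rightarrow> 'v) \<Rightarrow> 'v set \<Rightarrow> nat \<Rightarrow> 'v \<Rightarrow> (nat \<Rightarrow> 'v) \<Rightarrow> 'a" where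
  "coordinate scl B r e = (\<lambda>a. module.representation scl B (a r) e)"

definition polynomial_functions ::
  "('a::field \<Rightarrow> 'v::ab_group_add \<Rightarrow> 'v) \<Rightarrow> 'v set \<Rightarrow> nat \<Rightarrow> ((nat \<Rightarrow> 'v) \<Rightarrow> 'a) set" where
  "polynomial_functions scl B m =
     generated_subalgebra {coordinate scl B r e | r e. r \<in> {1..m} \<and> e \<in> B}"

definition invariants ::
  "('a::field \<Rightarrow> 'v::ab_group_add \<Rightarrow> 'v) \<Rightarrow> 'v set \<Rightarrow> ('v \<Rightarrow> 'v \<Rightarrow> 'v) \<Rightarrow> nat \<Rightarrow>
   ((nat \<Rightarrow> 'v) \<Rightarrow> 'a) set" where
  "invariants scl B mul m =
     {f \<in> polynomial_functions scl B m. \<forall>g \<in> Aut scl mul. \<forall>a. f (\<lambda>r. g (a r)) = f a}"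


section \<open>Operator traces\<close>

datatype 'x nonassoc_word = Letter 'x | Prod "'x nonassoc_word" "'x nonassoc_word"

text \<open>
  The absolutely free unital algebra in the letters \<open>\<chi>\<^sub>0, \<chi>\<^sub>1, \<dots>\<close>, as a vector space: the
  monomials are the unit, represented by \<open>None\<close>, and the non-empty non-associative words.
  The letter \<open>\<chi>\<^sub>r\<close> is the number \<open>r\<close>.
\<close>

type_synonym 'a free_nonassoc = "nat nonassoc_word option \<Rightarrow>\<^sub>0 'a"

primrec word_degree :: "'x \<Rightarrow> 'x nonassoc_word \<Rightarrow> nat" where
  "word_degree x (Letter y) = (if x = y then 1 else 0)"
| "word_degree x (Prod u v) = word_degree x u + word_degree x v"

definition monomial_degree :: "'x \<Rightarrow> 'x nonassoc_word option \<Rightarrow> nat" where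
  "monomial_degree x w = (case w of None \<Rightarrow> 0 | Some u \<Rightarrow> word_degree x u)"

definition monomial_letters :: "'x nonassoc_word option \<Rightarrow> 'x set" where
  "monomial_letters w = (case w of None \<Rightarrow> {} | Some u \<Rightarrow> set_nonassoc_word u)"

definition operator_polynomials :: "nat \<Rightarrow> 'a::field free_nonassoc set" where
  "operator_polynomials m =
     {h. \<forall>w \<in> Poly_Mapping.keys h. monomial_letters w \<subseteq> {0..m} \<and> monomial_degree 0 w = 1}"

primrec word_subst :: "('v \<Rightarrow> 'v \<Rightarrow> 'v) \<Rightarrow> ('x \<Rightarrow> 'v) \<Rightarrow> 'x nonassoc_word \<Rightarrow> 'v" where
  "word_subst mul s (Letter x) = s x"
| "word_subst mul s (Prod u v) = mul (word_subst mul s u) (word_subst mul s v)"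

text \<open>
  The algebra need not have a unit, so the value at \<open>None\<close> is a dummy. It is never used: the
  unit has degree 0 in \<open>\<chi>\<^sub>0\<close> and so does not occur in elements of \<open>operator_polynomials m\<close>.
\<close>

definition monomial_subst ::
  "('v \<Rightarrow> 'v \<Rightarrow> 'v) \<Rightarrow> ('x \<Rightarrow> 'v::zero) \<Rightarrow> 'x nonassoc_word option \<Rightarrow> 'v" where
  "monomial_subst mul s w = (case w of None \<Rightarrow> 0 | Some u \<Rightarrow> word_subst mul s u)"

definition free_subst ::
  "('a::field \<Rightarrow> 'v::ab_group_add \<Rightarrow> 'v) \<Rightarrow> ('v \<Rightarrow> 'v \<Rightarrow> 'v) \<Rightarrow> (nat \<Rightarrow> 'v) \<Rightarrow> 'a free_nonassoc \<Rightarrow> 'v" where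
  "free_subst scl mul s h = (\<Sum>w \<in> Poly_Mapping.keys h. scl (Poly_Mapping.lookup h w) (monomial_subst mul s w))"

definition linear_trace ::
  "('a::field \<Rightarrow> 'v::ab_group_add \<Rightarrow> 'v) \<Rightarrow> 'v set \<Rightarrow> ('v \<Rightarrow> 'v) \<Rightarrow> 'a" where
  "linear_trace scl B T = (\<Sum>e \<in> B. module.representation scl B (T e) e)"

definition operator_trace ::
  "('a::field \<Rightarrow> 'v::ab_group_add \<Rightarrow> 'v) \<Rightarrow> 'v set \<Rightarrow> ('v \<Rightarrow> 'v \<Rightarrow> 'v) \<Rightarrow>
   'a free_nonassoc \<Rightarrow> (nat \<Rightarrow> 'v) \<Rightarrow> 'a" where
  "operator_trace scl B mul h =
     (\<lambda>a. linear_trace scl B (\<lambda>b. free_subst scl mul (a(0 := b)) h))"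

definition trace_algebra ::
  "('a::field \<Rightarrow> 'v::ab_group_add \<Rightarrow> 'v) \<Rightarrow> 'v set \<Rightarrow> ('v \<Rightarrow> 'v \<Rightarrow> 'v) \<Rightarrow> nat \<Rightarrow>
   ((nat \<Rightarrow> 'v) \<Rightarrow> 'a) set" where
  "trace_algebra scl B mul m =
     generated_subalgebra (operator_trace scl B mul ` operator_polynomials m)"


section \<open>The exceptional two-dimensional algebras\<close>

abbreviation e1 :: "'a::field ^ 2" where "e1 \<equiv> axis 1 1"
abbreviation e2 :: "'a::field ^ 2" where "e2 \<equiv> axis 2 1"

text \<open>The arguments are the products \<open>e1 e1\<close>, \<open>e1 e2\<close>, \<open>e2 e1\<close> and \<open>e2 e2\<close>.\<close>

definition table_mult ::
  "'a::field ^ 2 \<Rightarrow> 'a ^ 2 \<Rightarrow> 'a ^ 2 \<Rightarrow> 'a ^ 2 \<Rightarrow> 'a ^ 2 \<Rightarrow> 'a ^ 2 \<Rightarrow> 'a ^ 2" where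
  "table_mult p11 p12 p21 p22 x y =
     (x $ 1 * y $ 1) *s p11 + (x $ 1 * y $ 2) *s p12 +
     (x $ 2 * y $ 1) *s p21 + (x $ 2 * y $ 2) *s p22"

definition A1_mult :: "'a::field \<Rightarrow> 'a ^ 2 \<Rightarrow> 'a ^ 2 \<Rightarrow> 'a ^ 2" where
  "A1_mult \<alpha> = table_mult (e1 + e2) (\<alpha> *s e2) ((1 - \<alpha>) *s e2) 0"

definition A2_mult :: "'a::field ^ 2 \<Rightarrow> 'a ^ 2 \<Rightarrow> 'a ^ 2" where
  "A2_mult = table_mult e2 e2 (- e2) 0"

text \<open>The algebra \<open>D\<^sub>2(-1, -1)\<close>.\<close>

definition D2_mult :: "'a::field ^ 2 \<Rightarrow> 'a ^ 2 \<Rightarrow> 'a ^ 2" where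
  "D2_mult = table_mult e1 (- e2) (- e2) 0"

end

theory Submission
  imports Defs
begin

text \<open>
  Let \<open>g\<close> be a nontrivial automorphism. Its Jordan form, compared with the structure constants
  in the corresponding basis \<open>u\<close>, \<open>v\<close>, leaves few multiplication tables
  (\<open>nontrivial_automorphism\<close>): in a basis of eigenvectors a structure constant vanishes unless
  weights match, and a Jordan block makes the algebra zero or of the form
  \<open>u u = (b + c) u + k v\<close>, \<open>u v = b v\<close>, \<open>v u = c v\<close>, \<open>v v = 0\<close>. Since operator traces are
  always invariant polynomials (\<open>trace_algebra_subset_invariants\<close>), and since neither side
  of the equality depends on the basis, the equality only requires, for each table, enough
  automorphisms to bound the invariants from above and enough traces to reach this bound.

  There are two sources of upper bounds. If there is a family of automorphisms \<open>g\<^sub>t\<close>,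
  polynomial in \<open>t \<noteq> 0\<close>, then an invariant takes the same value at \<open>a\<close> and at
  \<open>g\<^sub>0 a\<close> (\<open>polynomial_limit\<close>); as \<open>g\<^sub>0\<close> is zero or a projection, the invariant is a
  constant or a polynomial in the \<open>u\<close>-coordinates. For a single vector the shears
  \<open>u \<mapsto> u + t v\<close> have the same effect (\<open>equality_shear\<close>). If only finitely many automorphisms
  are at hand, then the invariants are spanned by averages of monomials
  (\<open>invariants_subset_by_averaging\<close>). This occurs for a reflection (\<open>equality_reflection\<close>) and
  for the algebra \<open>u u = v\<close>, \<open>v v = u\<close>, \<open>u v = v u = 0\<close> with the symmetric group on three
  letters (\<open>equality_S3\<close>). The matching traces are those of left and right multiplications by
  \<open>x\<close> and by \<open>x y\<close>; for the symmetric group they are the trace form and a cubic form.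

  The exceptions are the tables where this fails. In \<open>A\<^sub>1(\<alpha>)\<close> and \<open>A\<^sub>2\<close> all automorphisms
  have determinant one, so for \<open>m > 1\<close> the determinant of two vectors is invariant, while
  operators are triangular and their traces see only the \<open>u\<close>-coordinates
  (\<open>inequality_shear\<close>). In \<open>D\<^sub>2(-1, -1)\<close> the \<open>u\<close>-coordinate itself is invariant, while all
  traces linear in \<open>a\<close> vanish (\<open>inequality_D2\<close>).
\<close>


section \<open>Subalgebras of functions\<close>

lemma generated_subalgebra_const: "(\<lambda>_. c) \<in> generated_subalgebra G"
  using generated_subalgebra.scale[OF generated_subalgebra.one, of c] by simp

lemma generated_subalgebra_diff:
  assumes "f \<in> generated_subalgebra G" "g \<in> generated_subalgebra G"
  shows "(\<lambda>x. f x - g x) \<in> generated_subalgebra G"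
  using generated_subalgebra.add[OF assms(1) generated_subalgebra.scale[OF assms(2), of "-1"]]
  by simp

lemma generated_subalgebra_sum:
  assumes "\<And>i. i \<in> I \<Longrightarrow> f i \<in> generated_subalgebra G"
  shows "(\<lambda>x. \<Sum>i\<in>I. f i x) \<in> generated_subalgebra G"
  using assms
proof (induction I rule: infinite_finite_induct)
  case (insert i I)
  then show ?case
    using generated_subalgebra.add[of "f i" G "\<lambda>x. \<Sum>i\<in>I. f i x"] by simp
qed (auto intro: generated_subalgebra_const)

lemma generated_subalgebra_subset:
  assumes "G \<subseteq> generated_subalgebra H"
  shows "generated_subalgebra G \<subseteq> generated_subalgebra H"
proof
  fix f assume "f \<in> generated_subalgebra G"
  then show "f \<in> generated_subalgebra H"
    using assms by induction (auto intro: generated_subalgebra.intros)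
qed


section \<open>Independence of the basis\<close>

context finite_dimensional_vector_space
begin

lemma representation_Basis_add:
  "representation Basis (x + y) b = representation Basis x b + representation Basis y b"
  using representation_add[OF independent_Basis, of y x] by (simp add: span_Basis)

lemma representation_Basis_scale:
  "representation Basis (scale c x) b = c * representation Basis x b"
  using representation_scale[OF independent_Basis, of x c] by (simp add: span_Basis)

lemma representation_Basis_sum:
  "representation Basis (\<Sum>i\<in>I. f i) b = (\<Sum>i\<in>I. representation Basis (f i) b)"
  using representation_sum[OF independent_Basis, of I f] by (simp add: span_Basis)

lemma representation_Basis_expand: "(\<Sum>b\<in>Basis. scale (representation Basis x b) b) = x"
  using sum_representation_eq[OF independent_Basis, of x Basis] finite_Basis
  by (simp add: span_Basis)

lemma representation_Basis_linear:
  assumes "Vector_Spaces.linear scale scale T"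
  shows "representation Basis (T x) b
    = (\<Sum>u\<in>Basis. representation Basis x u * representation Basis (T u) b)"
proof -
  interpret T: Vector_Spaces.linear scale scale T by fact
  have "T x = (\<Sum>u\<in>Basis. scale (representation Basis x u) (T u))"
    by (subst representation_Basis_expand[of x, symmetric]) (simp add: T.sum T.scale)
  then show ?thesis
    by (simp add: representation_Basis_sum representation_Basis_scale)
qed

text \<open>
  Used below to see that conjugating an operator by an automorphism keeps its trace.
\<close>

lemma linear_trace_commute:
  assumes "Vector_Spaces.linear scale scale S" "Vector_Spaces.linear scale scale T"
  shows "linear_trace scale Basis (\<lambda>x. S (T x)) = linear_trace scale Basis (\<lambda>x. T (S x))"
proof -
  let ?r = "\<lambda>x b. representation Basis x b"
  have "linear_trace scale Basis (\<lambda>x. S (T x))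
      = (\<Sum>e\<in>Basis. \<Sum>u\<in>Basis. ?r (T e) u * ?r (S u) e)"
    unfolding linear_trace_def by (subst representation_Basis_linear[OF assms(1)]) simp
  also have "\<dots> = (\<Sum>u\<in>Basis. \<Sum>e\<in>Basis. ?r (S u) e * ?r (T e) u)"
    by (subst sum.swap) (simp add: mult.commute)
  also have "\<dots> = linear_trace scale Basis (\<lambda>x. T (S x))"
    unfolding linear_trace_def by (subst representation_Basis_linear[OF assms(2)]) simp
  finally show ?thesis .
qed

text \<open>
  The usual argument for basis independence: expand each \<open>e \<in> B\<close> in the basis \<open>B'\<close> inside
  \<open>T e\<close>, exchange the sums, and recognise the expansion of \<open>T u\<close> in the basis \<open>B\<close>.
\<close>

lemma linear_trace_basis:
  assumes "Vector_Spaces.linear scale scale T" "finite_dimensional_vector_space scale B'"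
  shows "linear_trace scale Basis T = linear_trace scale B' T"
proof -
  interpret T: Vector_Spaces.linear scale scale T by fact
  interpret B': finite_dimensional_vector_space scale B' by fact
  let ?r = "\<lambda>x b. representation Basis x b" and ?r' = "\<lambda>x b. representation B' x b"
  have Te: "?r (T e) b = (\<Sum>u\<in>B'. ?r' e u * ?r (T u) b)" for e b
  proof -
    have "T e = (\<Sum>u\<in>B'. scale (?r' e u) (T u))"
      by (subst B'.representation_Basis_expand[of e, symmetric]) (simp add: T.sum T.scale)
    then show ?thesis
      by (simp add: representation_Basis_sum representation_Basis_scale)
  qed
  have Tu: "?r' (T u) u = (\<Sum>e\<in>Basis. ?r (T u) e * ?r' e u)" for u
    by (subst representation_Basis_expand[of "T u", symmetric])
       (simp add: B'.representation_Basis_sum B'.representation_Basis_scale)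
  have "linear_trace scale Basis T = (\<Sum>e\<in>Basis. \<Sum>u\<in>B'. ?r' e u * ?r (T u) e)"
    unfolding linear_trace_def by (rule sum.cong[OF refl Te])
  also have "\<dots> = (\<Sum>u\<in>B'. \<Sum>e\<in>Basis. ?r (T u) e * ?r' e u)"
    by (subst sum.swap) (simp add: mult.commute)
  also have "\<dots> = linear_trace scale B' T"
    unfolding linear_trace_def by (rule sum.cong[OF refl Tu[symmetric]])
  finally show ?thesis .
qed

lemma coordinate_in_polynomial_functions:
  assumes "r \<in> {1..m}" "b \<in> Basis"
  shows "(\<lambda>a. representation Basis (a r) b) \<in> polynomial_functions scale Basis m"
  unfolding polynomial_functions_def coordinate_def
  using assms by (intro generated_subalgebra.gen) auto

lemma polynomial_functions_basis_subset:
  assumes "finite_dimensional_vector_space scale B'"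
  shows "polynomial_functions scale B' m \<subseteq> polynomial_functions scale Basis m"
proof -
  interpret B': finite_dimensional_vector_space scale B' by fact
  have "coordinate scale B' r e' \<in> polynomial_functions scale Basis m" if "r \<in> {1..m}" for r e'
  proof -
    have eq: "coordinate scale B' r e' =
      (\<lambda>a. \<Sum>e\<in>Basis. representation B' e e' * representation Basis (a r) e)"
    proof
      fix a
      show "coordinate scale B' r e' a =
          (\<Sum>e\<in>Basis. representation B' e e' * representation Basis (a r) e)"
        unfolding coordinate_def
        by (subst representation_Basis_expand[of "a r", symmetric])
          (simp add: B'.representation_Basis_sum B'.representation_Basis_scale mult.commute)
    qed
    show ?thesis
      unfolding eq polynomial_functions_def
      using coordinate_in_polynomial_functions[OF that]
      by (intro generated_subalgebra_sum generated_subalgebra.scale)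
         (simp add: polynomial_functions_def)
  qed
  then show ?thesis
    unfolding polynomial_functions_def by (intro generated_subalgebra_subset) auto
qed

end

lemma polynomial_functions_basis:
  assumes "finite_dimensional_vector_space scl B" "finite_dimensional_vector_space scl B'"
  shows "polynomial_functions scl B m = polynomial_functions scl B' m"
  using finite_dimensional_vector_space.polynomial_functions_basis_subset assms by blast


section \<open>Words as operators\<close>

lemma word_subst_fun_upd:
  "word_degree k w = 0 \<Longrightarrow> word_subst mul (s(k := b)) w = word_subst mul s w"
  by (induction w) (auto split: if_splits)

lemma word_subst_hom:
  assumes "\<And>x y. g (mul x y) = mul' (g x) (g y)"
  shows "g (word_subst mul s w) = word_subst mul' (\<lambda>x. g (s x)) w"
  by (induction w) (simp_all add: assms)

context nonassoc_algebra
begin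

lemma mul_add_left: "mul (x + y) z = mul x z + mul y z"
  and mul_scale_left: "mul (scl c x) z = scl c (mul x z)"
proof -
  interpret L: Vector_Spaces.linear scl scl "\<lambda>x. mul x z" by (rule linear_mult_left)
  show "mul (x + y) z = mul x z + mul y z" "mul (scl c x) z = scl c (mul x z)"
    by (rule L.add L.scale)+
qed

lemma mul_add_right: "mul z (x + y) = mul z x + mul z y"
  and mul_scale_right: "mul z (scl c x) = scl c (mul z x)"
proof -
  interpret L: Vector_Spaces.linear scl scl "\<lambda>x. mul z x" by (rule linear_mult_right)
  show "mul z (x + y) = mul z x + mul z y" "mul z (scl c x) = scl c (mul z x)"
    by (rule L.add L.scale)+
qed

lemma linear_selfI:
  assumes "\<And>x y. T (x + y) = T x + T y" "\<And>c x. T (scl c x) = scl c (T x)"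
  shows "Vector_Spaces.linear scl scl T"
  using assms by unfold_locales (auto simp: scale_right_distrib scale_left_distrib)

lemma word_subst_linear:
  assumes "word_degree k w = 1"
  shows "Vector_Spaces.linear scl scl (\<lambda>b. word_subst mul (s(k := b)) w)"
  using assms
proof (induction w)
  case (Letter x)
  then show ?case by (auto intro!: linear_selfI split: if_splits)
next
  case (Prod u v)
  show ?case
  proof (cases "word_degree k u = 0")
    case True
    then have deg: "word_degree k v = 1" using Prod.prems by simp
    interpret v: Vector_Spaces.linear scl scl "\<lambda>b. word_subst mul (s(k := b)) v"
      by (rule Prod.IH(2)[OF deg])
    show ?thesis
      using True by (intro linear_selfI)
        (simp_all add: word_subst_fun_upd v.add v.scale mul_add_right mul_scale_right
          del: fun_upd_apply)
  next
    case False
    then have deg: "word_degree k u = 1" "word_degree k v = 0" using Prod.prems by simp_all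
    interpret u: Vector_Spaces.linear scl scl "\<lambda>b. word_subst mul (s(k := b)) u"
      by (rule Prod.IH(1)[OF deg(1)])
    show ?thesis
      using deg by (intro linear_selfI)
        (simp_all add: word_subst_fun_upd u.add u.scale mul_add_left mul_scale_left
          del: fun_upd_apply)
  qed
qed

lemma operator_polynomials_keys:
  assumes "h \<in> operator_polynomials m" "w \<in> Poly_Mapping.keys h"
  obtains u where "w = Some u" "word_degree 0 u = 1" "set_nonassoc_word u \<subseteq> {0..m}"
  using assms
  by (cases w) (auto simp: operator_polynomials_def monomial_degree_def monomial_letters_def)

lemma free_subst_linear:
  assumes "h \<in> operator_polynomials m"
  shows "Vector_Spaces.linear scl scl (\<lambda>b. free_subst scl mul (s(0 := b)) h)"
proof -
  have lin: "Vector_Spaces.linear scl scl (\<lambda>b. monomial_subst mul (s(0 := b)) w)"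
    if w: "w \<in> Poly_Mapping.keys h" for w
    using operator_polynomials_keys[OF assms w]
    by (metis (no_types, lifting) ext monomial_subst_def option.simps(5) word_subst_linear)
  have add: "monomial_subst mul (s(0 := x + y)) w
      = monomial_subst mul (s(0 := x)) w + monomial_subst mul (s(0 := y)) w"
    and scale: "monomial_subst mul (s(0 := scl c x)) w = scl c (monomial_subst mul (s(0 := x)) w)"
    if w: "w \<in> Poly_Mapping.keys h" for w x y c
  proof -
    interpret l: Vector_Spaces.linear scl scl "\<lambda>b. monomial_subst mul (s(0 := b)) w"
      by (rule lin[OF w])
    show "monomial_subst mul (s(0 := x + y)) w
      = monomial_subst mul (s(0 := x)) w + monomial_subst mul (s(0 := y)) w"
      "monomial_subst mul (s(0 := scl c x)) w = scl c (monomial_subst mul (s(0 := x)) w)"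
      by (rule l.add l.scale)+
  qed
  show ?thesis
    unfolding free_subst_def
    by (intro linear_selfI)
       (simp_all add: add scale scale_right_distrib sum.distrib scale_sum_right
          mult.commute cong: sum.cong)
qed

lemma trace_algebra_basis:
  assumes "finite_dimensional_vector_space scl B'"
  shows "trace_algebra scl B mul m = trace_algebra scl B' mul m"
proof -
  have "operator_trace scl B mul h = operator_trace scl B' mul h"
    if "h \<in> operator_polynomials m" for h
    unfolding operator_trace_def
    using linear_trace_basis[OF free_subst_linear[OF that] assms] by auto
  then show ?thesis unfolding trace_algebra_def by (metis image_cong)
qed

lemma invariants_basis:
  assumes "finite_dimensional_vector_space scl B'"
  shows "invariants scl B mul m = invariants scl B' mul m"
  unfolding invariants_def
  using polynomial_functions_basis[OF finite_dimensional_vector_space_axioms assms, of m] by simp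


section \<open>Operator traces are invariant polynomials\<close>

lemma representation_mul:
  "representation B (mul x y) b =
    (\<Sum>u\<in>B. \<Sum>v\<in>B. representation B (mul u v) b * (representation B x u * representation B y v))"
proof -
  have "representation B (mul x y) b
      = (\<Sum>u\<in>B. representation B x u * representation B (mul u y) b)"
    by (rule representation_Basis_linear[OF linear_mult_left])
  also have "\<dots> = (\<Sum>u\<in>B. representation B x u *
      (\<Sum>v\<in>B. representation B y v * representation B (mul u v) b))"
    by (intro sum.cong refl arg_cong2[of _ _ _ _ "(*)"]
        representation_Basis_linear[OF linear_mult_right])
  also have "\<dots> = (\<Sum>u\<in>B. \<Sum>v\<in>B. representation B (mul u v) b
      * (representation B x u * representation B y v))"
    by (simp add: sum_distrib_left mult_ac)
  finally show ?thesis .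
qed

lemma word_subst_polynomial:
  assumes "set_nonassoc_word w \<subseteq> {0..m}" "c \<in> B"
  shows "(\<lambda>a. representation B (word_subst mul (a(0 := b)) w) c) \<in> polynomial_functions scl B m"
  using assms
proof (induction w arbitrary: c)
  case (Letter x)
  then show ?case
    using coordinate_in_polynomial_functions[of x m c]
    by (cases "x = 0") (auto simp: polynomial_functions_def generated_subalgebra_const)
next
  case (Prod u v)
  show ?case
    unfolding word_subst.simps polynomial_functions_def
    by (subst representation_mul)
       (intro generated_subalgebra_sum generated_subalgebra.scale generated_subalgebra.mult
          Prod.IH[unfolded polynomial_functions_def]; use Prod.prems in simp)
qed

lemma operator_trace_polynomial:
  assumes "h \<in> operator_polynomials m"
  shows "operator_trace scl B mul h \<in> polynomial_functions scl B m"
proof -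
  have mono: "(\<lambda>a. representation B (monomial_subst mul (a(0 := b)) w) c)
      \<in> polynomial_functions scl B m" if w: "w \<in> Poly_Mapping.keys h" and "c \<in> B" for w b c
  proof -
    obtain u where "w = Some u" "set_nonassoc_word u \<subseteq> {0..m}"
      using operator_polynomials_keys[OF assms w] by blast
    then show ?thesis
      using word_subst_polynomial[of u m c b] that by (simp add: monomial_subst_def)
  qed
  show ?thesis
    unfolding operator_trace_def linear_trace_def free_subst_def representation_Basis_sum
      representation_Basis_scale
      polynomial_functions_def
    by (intro generated_subalgebra_sum generated_subalgebra.scale)
       (use mono in \<open>auto simp: polynomial_functions_def\<close>)
qed

text \<open>
  Moving the point \<open>a\<close> by an automorphism \<open>g\<close> conjugates the operator \<open>h(-, a)\<close> by \<open>g\<close>.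
\<close>

lemma operator_trace_Aut:
  assumes h: "h \<in> operator_polynomials m" and g: "g \<in> Aut scl mul"
  shows "operator_trace scl B mul h (\<lambda>r. g (a r)) = operator_trace scl B mul h a"
proof -
  from g have "Vector_Spaces.linear scl scl g" and bij: "bij g"
    and hom: "\<And>x y. g (mul x y) = mul (g x) (g y)"
    by (auto simp: Aut_def algebra_iso_def)
  then interpret g: Vector_Spaces.linear scl scl g by simp
  define T where "T a b = free_subst scl mul (a(0 := b)) h" for a b
  have mono: "monomial_subst mul ((\<lambda>r. g (a r))(0 := g b)) w = g (monomial_subst mul (a(0 := b)) w)"
    if w: "w \<in> Poly_Mapping.keys h" for w b
  proof -
    obtain u where "w = Some u" using operator_polynomials_keys[OF h w] by blast
    moreover have "(\<lambda>r. g ((a(0 := b)) r)) = (\<lambda>r. g (a r))(0 := g b)" by auto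
    ultimately show ?thesis
      using word_subst_hom[of g mul mul "a(0 := b)" u] hom by (simp add: monomial_subst_def)
  qed
  have Tg: "T (\<lambda>r. g (a r)) (g b) = g (T a b)" for b
    unfolding T_def free_subst_def using mono by (simp add: g.sum g.scale)
  have lin: "Vector_Spaces.linear scl scl (T a)" for a
    unfolding T_def by (rule free_subst_linear[OF h])
  have lin_inv: "Vector_Spaces.linear scl scl (inv g)"
  proof (rule linear_selfI)
    show "inv g (x + y) = inv g x + inv g y" for x y
      using bij by (intro inv_f_eq) (auto simp: bij_is_inj g.add bij_is_surj surj_f_inv_f)
    show "inv g (scl c x) = scl c (inv g x)" for c x
      using bij by (intro inv_f_eq) (auto simp: bij_is_inj g.scale bij_is_surj surj_f_inv_f)
  qed
  have "T (\<lambda>r. g (a r)) = (\<lambda>b. g (T a (inv g b)))"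
    using Tg[of "inv g b" for b] bij by (simp add: fun_eq_iff bij_is_surj surj_f_inv_f)
  then have "linear_trace scl B (T (\<lambda>r. g (a r))) = linear_trace scl B (\<lambda>b. g (T a (inv g b)))"
    by simp
  also have "\<dots> = linear_trace scl B (\<lambda>b. T a (inv g (g b)))"
  proof (rule linear_trace_commute)
    interpret Ta: Vector_Spaces.linear scl scl "T a" by (rule lin)
    interpret ig: Vector_Spaces.linear scl scl "inv g" by (rule lin_inv)
    show "Vector_Spaces.linear scl scl (\<lambda>b. T a (inv g b))"
      by (rule linear_selfI) (simp_all add: Ta.add Ta.scale ig.add ig.scale)
  qed fact
  also have "\<dots> = linear_trace scl B (T a)" using bij by (simp add: bij_is_inj)
  finally show ?thesis unfolding operator_trace_def T_def[abs_def] .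
qed

lemma generated_subalgebra_subset_invariants:
  assumes "G \<subseteq> invariants scl B mul m"
  shows "generated_subalgebra G \<subseteq> invariants scl B mul m"
proof
  fix f assume "f \<in> generated_subalgebra G"
  then show "f \<in> invariants scl B mul m"
    using assms
    by induction (auto simp: invariants_def polynomial_functions_def
        intro: generated_subalgebra.intros)
qed

lemma trace_algebra_subset_invariants: "trace_algebra scl B mul m \<subseteq> invariants scl B mul m"
  unfolding trace_algebra_def
  by (rule generated_subalgebra_subset_invariants)
     (auto simp: invariants_def operator_trace_polynomial operator_trace_Aut)

lemma word_trace_in_trace_algebra:
  assumes "word_degree 0 w = 1" "set_nonassoc_word w \<subseteq> {0..m}"
  shows "(\<lambda>a. linear_trace scl B (\<lambda>b. word_subst mul (a(0 := b)) w)) \<in> trace_algebra scl B mul m"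
proof -
  define h :: "'a free_nonassoc" where "h = Poly_Mapping.single (Some w) 1"
  have "h \<in> operator_polynomials m"
    using assms
    by (auto simp: h_def operator_polynomials_def monomial_degree_def monomial_letters_def)
  moreover have "operator_trace scl B mul h
      = (\<lambda>a. linear_trace scl B (\<lambda>b. word_subst mul (a(0 := b)) w))"
    by (simp add: operator_trace_def free_subst_def h_def monomial_subst_def)
  ultimately show ?thesis
    unfolding trace_algebra_def by (metis generated_subalgebra.gen imageI)
qed

end


section \<open>Coordinates in dimension two\<close>

definition mult_table ::
  "('a::field \<Rightarrow> 'v::ab_group_add \<Rightarrow> 'v) \<Rightarrow> 'v \<Rightarrow> 'v \<Rightarrow> ('v \<Rightarrow> 'v \<Rightarrow> 'v) \<Rightarrow>
   'a \<Rightarrow> 'a \<Rightarrow> 'a \<Rightarrow> 'a \<Rightarrow> 'a \<Rightarrow> 'a \<Rightarrow> 'a \<Rightarrow> 'a \<Rightarrow> bool" where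
  "mult_table scl u v mul a a' b b' c c' d d' \<longleftrightarrow>
     mul u u = scl a u + scl a' v \<and> mul u v = scl b u + scl b' v \<and>
     mul v u = scl c u + scl c' v \<and> mul v v = scl d u + scl d' v"

locale plane_algebra = nonassoc_algebra scl "{u, v}" mul
  for scl :: "'a::field \<Rightarrow> 'v::ab_group_add \<Rightarrow> 'v" and u v :: 'v and mul +
  assumes distinct: "u \<noteq> v"
begin

definition cu :: "'v \<Rightarrow> 'a" where "cu x = representation {u, v} x u"
definition cv :: "'v \<Rightarrow> 'a" where "cv x = representation {u, v} x v"

lemma coords_add [simp]: "cu (x + y) = cu x + cu y" "cv (x + y) = cv x + cv y"
  and coords_scale [simp]: "cu (scl k x) = k * cu x" "cv (scl k x) = k * cv x"
  by (simp_all add: cu_def cv_def representation_Basis_add representation_Basis_scale)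

lemma coords_zero [simp]: "cu 0 = 0" "cv 0 = 0"
  using coords_scale[of 0 0] by simp_all

lemma coords_minus [simp]: "cu (- x) = - cu x" "cv (- x) = - cv x"
  using coords_add[of x "- x"] by (simp_all add: eq_neg_iff_add_eq_0 add.commute)

lemma coords_diff [simp]: "cu (x - y) = cu x - cu y" "cv (x - y) = cv x - cv y"
  using coords_add[of x "- y"] by simp_all

lemma coords_basis [simp]: "cu u = 1" "cv u = 0" "cu v = 0" "cv v = 1"
  using distinct representation_basis[OF independent_Basis] by (simp_all add: cu_def cv_def)

lemma coords_expand: "scl (cu x) u + scl (cv x) v = x"
  using representation_Basis_expand[of x] distinct by (simp add: cu_def cv_def)

lemma coords_eqI: "cu x = cu y \<Longrightarrow> cv x = cv y \<Longrightarrow> x = y"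
  using coords_expand by metis

lemma linear_trace_coords: "linear_trace scl {u, v} T = cu (T u) + cv (T v)"
  using distinct by (simp add: linear_trace_def cu_def cv_def)

lemma mul_coords:
  "cu (mul x y) = cu x * cu y * cu (mul u u) + cu x * cv y * cu (mul u v)
     + cv x * cu y * cu (mul v u) + cv x * cv y * cu (mul v v)"
  "cv (mul x y) = cu x * cu y * cv (mul u u) + cu x * cv y * cv (mul u v)
     + cv x * cu y * cv (mul v u) + cv x * cv y * cv (mul v v)"
proof -
  have "mul x y = mul (scl (cu x) u + scl (cv x) v) (scl (cu y) u + scl (cv y) v)"
    by (simp only: coords_expand)
  then show "cu (mul x y) = cu x * cu y * cu (mul u u) + cu x * cv y * cu (mul u v)
     + cv x * cu y * cu (mul v u) + cv x * cv y * cu (mul v v)"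
    "cv (mul x y) = cu x * cu y * cv (mul u u) + cu x * cv y * cv (mul u v)
     + cv x * cu y * cv (mul v u) + cv x * cv y * cv (mul v v)"
    by (simp_all add: mul_add_left mul_add_right mul_scale_left mul_scale_right algebra_simps)
qed

lemma mult_table_iff:
  "mult_table scl u v mul a a' b b' c c' d d' \<longleftrightarrow>
     cu (mul u u) = a \<and> cv (mul u u) = a' \<and> cu (mul u v) = b \<and> cv (mul u v) = b' \<and>
     cu (mul v u) = c \<and> cv (mul v u) = c' \<and> cu (mul v v) = d \<and> cv (mul v v) = d'"
  unfolding mult_table_def by (auto intro: coords_eqI)

lemma mult_table_coords:
  assumes "mult_table scl u v mul a a' b b' c c' d d'"
  shows "cu (mul x y) = a * cu x * cu y + b * cu x * cv y + c * cv x * cu y + d * cv x * cv y"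
    "cv (mul x y) = a' * cu x * cu y + b' * cu x * cv y + c' * cv x * cu y + d' * cv x * cv y"
  using assms unfolding mult_table_iff by (simp_all add: mul_coords[of x y])

lemma mult_table_exists: "\<exists>a a' b b' c c' d d'. mult_table scl u v mul a a' b b' c c' d d'"
  unfolding mult_table_iff by blast

lemma linear_coords:
  assumes "Vector_Spaces.linear scl scl g"
  shows "cu (g x) = cu x * cu (g u) + cv x * cu (g v)"
    "cv (g x) = cu x * cv (g u) + cv x * cv (g v)"
proof -
  interpret g: Vector_Spaces.linear scl scl g by fact
  have "g x = g (scl (cu x) u + scl (cv x) v)" by (simp only: coords_expand)
  then have "g x = scl (cu x) (g u) + scl (cv x) (g v)" by (simp add: g.add g.scale)
  then show "cu (g x) = cu x * cu (g u) + cv x * cu (g v)"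
    "cv (g x) = cu x * cv (g u) + cv x * cv (g v)"
    by simp_all
qed

text \<open>
  The first two parameters give the image of \<open>u\<close>, the last two that of \<open>v\<close>.
\<close>

definition matrix_map :: "'a \<Rightarrow> 'a \<Rightarrow> 'a \<Rightarrow> 'a \<Rightarrow> 'v \<Rightarrow> 'v" where
  "matrix_map p q r s x = scl (p * cu x + r * cv x) u + scl (q * cu x + s * cv x) v"

lemma matrix_map_coords [simp]:
  "cu (matrix_map p q r s x) = p * cu x + r * cv x"
  "cv (matrix_map p q r s x) = q * cu x + s * cv x"
  by (simp_all add: matrix_map_def)

lemma matrix_map_Aut:
  assumes det: "p * s - q * r \<noteq> 0"
    and hom: "\<And>x y. matrix_map p q r s (mul x y) = mul (matrix_map p q r s x) (matrix_map p q r s y)"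
  shows "matrix_map p q r s \<in> Aut scl mul"
proof -
  define D where "D = p * s - q * r"
  have D: "D \<noteq> 0" using det by (simp add: D_def)
  let ?g = "matrix_map p q r s" and ?h = "matrix_map (s / D) (- q / D) (- r / D) (p / D)"
  have "?h (?g x) = x" "?g (?h x) = x" for x
    using D by (auto intro!: coords_eqI simp: field_simps) (simp_all add: D_def algebra_simps)
  then have "bij ?g" by (metis bij_def inj_on_inverseI surjI)
  moreover have "Vector_Spaces.linear scl scl ?g"
    by (intro linear_selfI coords_eqI) (simp_all add: algebra_simps)
  ultimately show ?thesis using hom by (simp add: Aut_def algebra_iso_def)
qed

lemma algebra_isomorphic_table_mult:
  assumes "mult_table scl u v mul (p11 $ 1) (p11 $ 2) (p12 $ 1) (p12 $ 2)
    (p21 $ 1) (p21 $ 2) (p22 $ 1) (p22 $ 2)"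
  shows "algebra_isomorphic scl mul (*s) (table_mult p11 p12 p21 p22)"
proof -
  define \<phi> :: "'v \<Rightarrow> 'a ^ 2" where "\<phi> x = vector [cu x, cv x]" for x
  have comp: "\<phi> x $ 1 = cu x" "\<phi> x $ 2 = cv x" for x by (simp_all add: \<phi>_def)
  have "Vector_Spaces.linear scl (*s) \<phi>"
    using vec.vector_space_axioms
    by unfold_locales
       (simp_all add: vec_eq_iff forall_2 comp vector_space_def algebra_simps scale_right_distrib
         scale_left_distrib)
  moreover have "bij \<phi>"
  proof (rule bijI)
    show "inj \<phi>" by (rule injI) (metis comp coords_eqI)
    have "\<phi> (scl (w $ 1) u + scl (w $ 2) v) = w" for w
      by (simp add: vec_eq_iff forall_2 comp)
    then show "surj \<phi>" by (rule surjI)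
  qed
  moreover have "\<phi> (mul x y) = table_mult p11 p12 p21 p22 (\<phi> x) (\<phi> y)" for x y
    by (simp add: vec_eq_iff forall_2 comp table_mult_def mult_table_coords[OF assms] algebra_simps)
  ultimately show ?thesis unfolding algebra_isomorphic_def algebra_iso_def by blast
qed

end

context nonassoc_algebra
begin

text \<open>
  In dimension two a spanning pair is a basis.
\<close>

lemma plane_algebraI:
  assumes card: "card B = 2" and span: "\<And>x. \<exists>k l. x = scl k u + scl l v"
  shows "plane_algebra scl u v mul"
proof -
  have UNIV: "span {u, v} = UNIV"
  proof (rule equalityI[OF subset_UNIV subsetI])
    fix x
    obtain k l where "x = scl k u + scl l v" using span by blast
    then show "x \<in> span {u, v}"
      by (auto intro!: span_add span_scale intro: span_base)
  qed
  have dim: "dim UNIV = 2" using card by (simp add: dim_UNIV)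
  have "dim UNIV \<le> card {u, v}"
    using UNIV by (intro span_card_ge_dim) auto
  then have "u \<noteq> v" using dim by auto
  then have "independent {u, v}"
    using UNIV dim by (intro card_le_dim_spanning[of _ UNIV]) auto
  with UNIV have "finite_dimensional_vector_space scl {u, v}"
    by unfold_locales auto
  then show ?thesis
    using \<open>u \<noteq> v\<close> nonassoc_algebra_axioms
    by (simp add: plane_algebra_def plane_algebra_axioms_def nonassoc_algebra_def)
qed

lemma plane_algebra_exists:
  assumes "card B = 2"
  shows "\<exists>u v. plane_algebra scl u v mul \<and> B = {u, v}"
proof -
  obtain u v where "B = {u, v}" "u \<noteq> v" using assms by (meson card_2_iff)
  then show ?thesis
    using nonassoc_algebra_axioms by (auto simp: plane_algebra_def plane_algebra_axioms_def)
qed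

lemma table_of_algebra_isomorphic:
  assumes card: "card B = 2" and iso: "algebra_isomorphic scl mul (*s) (table_mult p11 p12 p21 p22)"
  shows "\<exists>u v. plane_algebra scl u v mul \<and> mult_table scl u v mul (p11 $ 1) (p11 $ 2)
    (p12 $ 1) (p12 $ 2) (p21 $ 1) (p21 $ 2) (p22 $ 1) (p22 $ 2)"
proof -
  obtain \<phi> where "Vector_Spaces.linear scl (*s) \<phi>" and bij: "bij \<phi>"
    and hom: "\<And>x y. \<phi> (mul x y) = table_mult p11 p12 p21 p22 (\<phi> x) (\<phi> y)"
    using iso unfolding algebra_isomorphic_def algebra_iso_def by blast
  then interpret \<phi>: Vector_Spaces.linear scl "(*s)" \<phi> by simp
  define u v where "u = inv \<phi> e1" and "v = inv \<phi> e2"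
  have uv: "\<phi> u = e1" "\<phi> v = e2"
    using bij by (simp_all add: u_def v_def bij_is_surj surj_f_inv_f)
  have eq: "x = scl k u + scl l v" if "\<phi> x $ 1 = k" "\<phi> x $ 2 = l" for x k l
  proof -
    have "\<phi> x = \<phi> (scl k u + scl l v)"
      using that by (simp add: \<phi>.add \<phi>.scale uv vec_eq_iff forall_2 axis_def)
    then show ?thesis using bij by (meson bij_is_inj injD)
  qed
  have "plane_algebra scl u v mul" using card eq by (intro plane_algebraI) blast+
  moreover have "mult_table scl u v mul (p11 $ 1) (p11 $ 2) (p12 $ 1) (p12 $ 2)
    (p21 $ 1) (p21 $ 2) (p22 $ 1) (p22 $ 2)"
    unfolding mult_table_def by (intro conjI eq) (simp_all add: hom uv table_mult_def axis_def)
  ultimately show ?thesis by blast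
qed

end

context plane_algebra
begin

lemma change_frame:
  assumes "cu u' * cv v' - cv u' * cu v' \<noteq> 0"
  shows "plane_algebra scl u' v' mul"
proof (rule plane_algebraI)
  show "card {u, v} = 2" using distinct by simp
  fix x
  define D where "D = cu u' * cv v' - cv u' * cu v'"
  have D: "D \<noteq> 0" using assms by (simp add: D_def)
  have "x = scl ((cu x * cv v' - cv x * cu v') / D) u' + scl ((cu u' * cv x - cv u' * cu x) / D) v'"
  proof (rule coords_eqI)
    show "cu x = cu (scl ((cu x * cv v' - cv x * cu v') / D) u' + scl ((cu u' * cv x - cv u' * cu x) / D) v')"
      using D by (simp add: field_simps) (simp add: D_def algebra_simps)
    show "cv x = cv (scl ((cu x * cv v' - cv x * cu v') / D) u' + scl ((cu u' * cv x - cv u' * cu x) / D) v')"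
      using D by (simp add: field_simps) (simp add: D_def algebra_simps)
  qed
  then show "\<exists>k l. x = scl k u' + scl l v'" by blast
qed

lemma frame_independent:
  assumes "plane_algebra scl u' v' mul"
  shows "invariants scl {u, v} mul m = invariants scl {u', v'} mul m"
    "trace_algebra scl {u, v} mul m = trace_algebra scl {u', v'} mul m"
proof -
  interpret p: plane_algebra scl u' v' mul by fact
  show "invariants scl {u, v} mul m = invariants scl {u', v'} mul m"
    "trace_algebra scl {u, v} mul m = trace_algebra scl {u', v'} mul m"
    by (rule invariants_basis trace_algebra_basis, rule p.finite_dimensional_vector_space_axioms)+
qed


section \<open>Polynomial functions along curves\<close>

lemma polynomial_functions_coords:
  "polynomial_functions scl {u, v} m
    = generated_subalgebra ({\<lambda>a. cu (a r) | r. r \<in> {1..m}} \<union> {\<lambda>a. cv (a r) | r. r \<in> {1..m}})"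
  unfolding polynomial_functions_def coordinate_def cu_def cv_def
  by (rule arg_cong[of _ _ generated_subalgebra]) auto

text \<open>
  Substitution. It is applied to a degenerate \<open>\<gamma>\<close>, whose coordinates involve few variables,
  in order to write an invariant in those variables.
\<close>

lemma polynomial_functions_compose:
  assumes "F \<in> polynomial_functions scl {u, v} m"
    and "\<And>r. r \<in> {1..m} \<Longrightarrow> (\<lambda>a. cu (\<gamma> a r)) \<in> generated_subalgebra G"
    and "\<And>r. r \<in> {1..m} \<Longrightarrow> (\<lambda>a. cv (\<gamma> a r)) \<in> generated_subalgebra G"
  shows "(\<lambda>a. F (\<gamma> a)) \<in> generated_subalgebra G"
  using assms(1) unfolding polynomial_functions_coords
proof induction
  case (gen F)
  then show ?case using assms(2,3) by blast
qed (auto intro: generated_subalgebra.intros)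

lemma polynomial_along_curve:
  assumes "F \<in> polynomial_functions scl {u, v} m"
    and "\<And>r. \<exists>P. \<forall>t. cu (\<gamma> t r) = poly P t" "\<And>r. \<exists>P. \<forall>t. cv (\<gamma> t r) = poly P t"
  shows "\<exists>P. \<forall>t. F (\<gamma> t) = poly P t"
  using assms(1) unfolding polynomial_functions_coords
proof induction
  case one
  have "\<forall>t. (1::'a) = poly 1 t" by simp
  then show ?case by blast
next
  case (gen F)
  then show ?case using assms(2,3) by blast
next
  case (add F G)
  then obtain P Q where "\<forall>t. F (\<gamma> t) = poly P t" "\<forall>t. G (\<gamma> t) = poly Q t" by blast
  then have "\<forall>t. F (\<gamma> t) + G (\<gamma> t) = poly (P + Q) t" by simp
  then show ?case by blast
next
  case (scale F k)
  then obtain P where "\<forall>t. F (\<gamma> t) = poly P t" by blast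
  then have "\<forall>t. k * F (\<gamma> t) = poly (smult k P) t" by simp
  then show ?case by blast
next
  case (mult F G)
  then obtain P Q where "\<forall>t. F (\<gamma> t) = poly P t" "\<forall>t. G (\<gamma> t) = poly Q t" by blast
  then have "\<forall>t. F (\<gamma> t) * G (\<gamma> t) = poly (P * Q) t" by simp
  then show ?case by blast
qed

end

lemma poly_const_off_zero:
  fixes P :: "'a::field_char_0 poly"
  assumes "\<And>t. t \<noteq> 0 \<Longrightarrow> poly P t = k"
  shows "poly P 0 = k"
proof -
  have "UNIV - {0} \<subseteq> {t. poly (P - [:k:]) t = 0}" using assms by auto
  moreover have "infinite (UNIV - {0::'a})" by (simp add: infinite_UNIV_char_0)
  ultimately have "P - [:k:] = 0" using poly_roots_finite infinite_super by blast
  then have "poly (P - [:k:]) 0 = 0" by simp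
  then show ?thesis by simp
qed

locale plane_algebra_char_0 = plane_algebra scl u v mul
  for scl :: "'a::field_char_0 \<Rightarrow> 'v::ab_group_add \<Rightarrow> 'v" and u v :: 'v and mul
begin

text \<open>
  For \<open>\<gamma> t = g\<^sub>t a\<close> with automorphisms \<open>g\<^sub>t\<close> for \<open>t \<noteq> 0\<close> that depend polynomially on \<open>t\<close>, this says
  that an invariant does not distinguish \<open>a\<close> from its image under the degenerate map \<open>g\<^sub>0\<close>.
\<close>

lemma polynomial_limit:
  assumes "F \<in> polynomial_functions scl {u, v} m"
    and "\<And>r. \<exists>P. \<forall>t. cu (\<gamma> t r) = poly P t" "\<And>r. \<exists>P. \<forall>t. cv (\<gamma> t r) = poly P t"
    and "\<And>t. t \<noteq> 0 \<Longrightarrow> F (\<gamma> t) = k"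
  shows "F (\<gamma> 0) = k"
proof -
  obtain P where P: "\<forall>t. F (\<gamma> t) = poly P t"
    using polynomial_along_curve[where \<gamma> = \<gamma>, OF assms(1-3)] by blast
  then have "poly P 0 = k" using assms(4) by (intro poly_const_off_zero) simp
  with P show ?thesis by simp
qed

end


section \<open>Equality of invariants and operator traces\<close>

lemma (in nonassoc_algebra) equality_of_generators:
  assumes "invariants scl B mul m \<subseteq> generated_subalgebra G" "G \<subseteq> trace_algebra scl B mul m"
  shows "invariants scl B mul m = trace_algebra scl B mul m"
proof -
  have "generated_subalgebra G \<subseteq> trace_algebra scl B mul m"
    using assms(2) unfolding trace_algebra_def by (rule generated_subalgebra_subset)
  then show ?thesis using assms(1) trace_algebra_subset_invariants by blast
qed

context plane_algebra
begin

lemma invariantsD: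
  assumes "F \<in> invariants scl {u, v} mul m"
  shows "F \<in> polynomial_functions scl {u, v} m"
    and "g \<in> Aut scl mul \<Longrightarrow> F (\<lambda>r. g (a r)) = F a"
  using assms by (auto simp: invariants_def)

abbreviation L_trace :: "'v \<Rightarrow> 'a" where "L_trace x \<equiv> linear_trace scl {u, v} (\<lambda>b. mul x b)"
abbreviation R_trace :: "'v \<Rightarrow> 'a" where "R_trace x \<equiv> linear_trace scl {u, v} (\<lambda>b. mul b x)"

lemma letter_traces:
  assumes "r \<in> {1..m}"
  shows "(\<lambda>a. L_trace (a r)) \<in> trace_algebra scl {u, v} mul m"
    "(\<lambda>a. R_trace (a r)) \<in> trace_algebra scl {u, v} mul m"
  using word_trace_in_trace_algebra[of "Prod (Letter r) (Letter 0)" m]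
    word_trace_in_trace_algebra[of "Prod (Letter 0) (Letter r)" m] assms
  by simp_all

lemma product_traces:
  assumes "r \<in> {1..m}" "s \<in> {1..m}"
  shows "(\<lambda>a. L_trace (mul (a r) (a s))) \<in> trace_algebra scl {u, v} mul m"
    "(\<lambda>a. R_trace (mul (a r) (a s))) \<in> trace_algebra scl {u, v} mul m"
  using word_trace_in_trace_algebra[of "Prod (Prod (Letter r) (Letter s)) (Letter 0)" m]
    word_trace_in_trace_algebra[of "Prod (Letter 0) (Prod (Letter r) (Letter s))" m] assms
  by simp_all

lemma composed_traces:
  assumes "r \<in> {1..m}" "s \<in> {1..m}" "t \<in> {1..m}"
  shows "(\<lambda>a. linear_trace scl {u, v} (\<lambda>b. mul (a r) (mul (a s) b))) \<in> trace_algebra scl {u, v} mul m"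
    "(\<lambda>a. linear_trace scl {u, v} (\<lambda>b. mul (mul (a r) (a s)) (mul (a t) b))) \<in> trace_algebra scl {u, v} mul m"
  using word_trace_in_trace_algebra[of "Prod (Letter r) (Prod (Letter s) (Letter 0))" m]
    word_trace_in_trace_algebra[of "Prod (Prod (Letter r) (Letter s)) (Prod (Letter t) (Letter 0))" m]
    assms
  by simp_all

lemma trace_algebra_const: "(\<lambda>_. k) \<in> trace_algebra scl {u, v} mul m"
  unfolding trace_algebra_def by (rule generated_subalgebra_const)

lemma trace_algebra_scale:
  "F \<in> trace_algebra scl {u, v} mul m \<Longrightarrow> (\<lambda>a. k * F a) \<in> trace_algebra scl {u, v} mul m"
  unfolding trace_algebra_def by (rule generated_subalgebra.scale)

lemma trace_algebra_descale:
  assumes "(\<lambda>a. k * F a) \<in> trace_algebra scl {u, v} mul m"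
    and "(\<lambda>a. l * F a) \<in> trace_algebra scl {u, v} mul m" and "k \<noteq> 0 \<or> l \<noteq> 0"
  shows "F \<in> trace_algebra scl {u, v} mul m"
  using trace_algebra_scale[OF assms(1), of "inverse k"]
    trace_algebra_scale[OF assms(2), of "inverse l"] assms(3)
  by (auto simp: mult.assoc[symmetric])

end

context plane_algebra_char_0
begin

lemma equality_if_only_constants:
  assumes "\<And>F. F \<in> invariants scl {u, v} mul m \<Longrightarrow> \<exists>k. \<forall>a. F a = k"
  shows "invariants scl {u, v} mul m = trace_algebra scl {u, v} mul m"
proof
  show "invariants scl {u, v} mul m \<subseteq> trace_algebra scl {u, v} mul m"
  proof
    fix F assume "F \<in> invariants scl {u, v} mul m"
    then obtain k where "F = (\<lambda>_. k)" using assms by blast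
    then show "F \<in> trace_algebra scl {u, v} mul m" by (simp add: trace_algebra_const)
  qed
qed (rule trace_algebra_subset_invariants)

text \<open>
  The automorphisms \<open>u \<mapsto> t u\<close>, \<open>v \<mapsto> t\<^sup>2 v\<close> contract the whole algebra to \<open>0\<close> as \<open>t\<close>
  tends to \<open>0\<close>, so every invariant is constant.
\<close>

lemma equality_square:
  assumes table: "mult_table scl u v mul 0 k 0 0 0 0 0 0"
  shows "invariants scl {u, v} mul m = trace_algebra scl {u, v} mul m"
proof (rule equality_if_only_constants)
  fix F assume F: "F \<in> invariants scl {u, v} mul m"
  let ?g = "\<lambda>t. matrix_map t 0 0 (t ^ 2)"
  have "F (\<lambda>_. 0) = F a" for a
  proof -
    have "F (\<lambda>r. ?g 0 (a r)) = F a"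
    proof (rule polynomial_limit[OF invariantsD(1)[OF F], where \<gamma> = "\<lambda>t r. ?g t (a r)"])
      show "\<exists>P. \<forall>t. cu (?g t (a r)) = poly P t" for r
        by (rule exI[of _ "[:0, cu (a r):]"]) simp
      show "\<exists>P. \<forall>t. cv (?g t (a r)) = poly P t" for r
        by (rule exI[of _ "[:0, 0, cv (a r):]"]) (simp add: power2_eq_square)
      show "F (\<lambda>r. ?g t (a r)) = F a" if "t \<noteq> 0" for t
      proof (rule invariantsD(2)[OF F], rule matrix_map_Aut)
        show "t * t ^ 2 - 0 * 0 \<noteq> 0" using that by simp
        show "?g t (mul x y) = mul (?g t x) (?g t y)" for x y
          by (rule coords_eqI)
            (simp_all add: mult_table_coords[OF table] power2_eq_square algebra_simps)
      qed
    qed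
    moreover have "?g 0 x = 0" for x by (rule coords_eqI) simp_all
    ultimately show ?thesis by simp
  qed
  then show "\<exists>k. \<forall>a. F a = k" by metis
qed

text \<open>
  The projection to the line of \<open>u\<close> turns an invariant that it preserves into a polynomial in
  the \<open>u\<close>-coordinates, and these are multiples of the traces of left or right multiplications.
\<close>

lemma equality_if_first_coordinates:
  assumes trace: "\<And>x. L_trace x = k * cu x" "\<And>x. R_trace x = l * cu x" "k \<noteq> 0 \<or> l \<noteq> 0"
    and inv: "\<And>F a. F \<in> invariants scl {u, v} mul m \<Longrightarrow> F (\<lambda>r. matrix_map 1 0 0 0 (a r)) = F a"
  shows "invariants scl {u, v} mul m = trace_algebra scl {u, v} mul m"
proof (rule equality_of_generators)
  let ?G = "{\<lambda>a. cu (a r) | r. r \<in> {1..m}}"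
  show "?G \<subseteq> trace_algebra scl {u, v} mul m"
  proof clarify
    fix r assume "r \<in> {1..m}"
    then have "(\<lambda>a. k * cu (a r)) \<in> trace_algebra scl {u, v} mul m"
      "(\<lambda>a. l * cu (a r)) \<in> trace_algebra scl {u, v} mul m"
      using letter_traces[of r m] by (simp_all add: trace)
    then show "(\<lambda>a. cu (a r)) \<in> trace_algebra scl {u, v} mul m"
      using trace(3) by (rule trace_algebra_descale)
  qed
  show "invariants scl {u, v} mul m \<subseteq> generated_subalgebra ?G"
  proof
    fix F assume F: "F \<in> invariants scl {u, v} mul m"
    have "(\<lambda>a. F (\<lambda>r. matrix_map 1 0 0 0 (a r))) \<in> generated_subalgebra ?G"
      by (rule polynomial_functions_compose[OF invariantsD(1)[OF F]])
         (auto intro: generated_subalgebra_const generated_subalgebra.gen)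
    then show "F \<in> generated_subalgebra ?G" using inv[OF F] by simp
  qed
qed

text \<open>
  The automorphisms \<open>v \<mapsto> t v\<close> degenerate, at \<open>t = 0\<close>, to the projection onto the line of \<open>u\<close>.
\<close>

lemma equality_torus:
  assumes table: "mult_table scl u v mul a 0 0 b 0 c 0 0" and "a + b \<noteq> 0 \<or> a + c \<noteq> 0"
  shows "invariants scl {u, v} mul m = trace_algebra scl {u, v} mul m"
proof (rule equality_if_first_coordinates)
  show "L_trace x = (a + b) * cu x" "R_trace x = (a + c) * cu x" for x
    by (simp_all add: linear_trace_coords mult_table_coords[OF table] algebra_simps)
  show "a + b \<noteq> 0 \<or> a + c \<noteq> 0" by fact
  fix F x assume F: "F \<in> invariants scl {u, v} mul m"
  let ?g = "\<lambda>t. matrix_map 1 0 0 t"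
  show "F (\<lambda>r. ?g 0 (x r)) = F x"
  proof (rule polynomial_limit[OF invariantsD(1)[OF F], where \<gamma> = "\<lambda>t r. ?g t (x r)"])
    show "\<exists>P. \<forall>t. cu (?g t (x r)) = poly P t" for r
      by (rule exI[of _ "[:cu (x r):]"]) simp
    show "\<exists>P. \<forall>t. cv (?g t (x r)) = poly P t" for r
      by (rule exI[of _ "[:0, cv (x r):]"]) simp
    show "F (\<lambda>r. ?g t (x r)) = F x" if "t \<noteq> 0" for t
    proof (rule invariantsD(2)[OF F], rule matrix_map_Aut)
      show "1 * t - 0 * 0 \<noteq> 0" using that by simp
      show "?g t (mul x y) = mul (?g t x) (?g t y)" for x y
        by (rule coords_eqI) (simp_all add: mult_table_coords[OF table] algebra_simps)
    qed
  qed
qed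

text \<open>
  The shears \<open>u \<mapsto> u + t v\<close> move \<open>(x, y)\<close> to \<open>(x, 0)\<close> whenever \<open>x \<noteq> 0\<close>, and the points with
  \<open>x = 0\<close> are limits of such points. A shear can do this for one vector only.
\<close>

lemma equality_shear:
  assumes table: "mult_table scl u v mul (b + c) q 0 b 0 c 0 0" and "b \<noteq> 0 \<or> c \<noteq> 0"
  shows "invariants scl {u, v} mul 1 = trace_algebra scl {u, v} mul 1"
proof (rule equality_if_first_coordinates)
  show "L_trace x = (b + c + b) * cu x" "R_trace x = (b + c + c) * cu x" for x
    by (simp_all add: linear_trace_coords mult_table_coords[OF table] algebra_simps)
  show "b + c + b \<noteq> 0 \<or> b + c + c \<noteq> 0"
  proof (rule ccontr)
    assume "\<not> ?thesis"
    then have zero: "b + c + b = 0" "b + c + c = 0" by simp_all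
    have "3 * b = 2 * (b + c + b) - (b + c + c)" "3 * c = 2 * (b + c + c) - (b + c + b)"
      by (simp_all add: algebra_simps)
    then have "b = 0" "c = 0" unfolding zero by simp_all
    then show False using assms(2) by simp
  qed
  fix F x assume F: "F \<in> invariants scl {u, v} mul 1"
  let ?p = "matrix_map 1 0 0 0"
  \<comment> \<open>For \<open>m = 1\<close> the value depends on the first entry of the sequence alone.\<close>
  have only: "F y = F z" if "y 1 = z 1" for y z
    using invariantsD(1)[OF F] that unfolding polynomial_functions_def
    by induction (auto simp: coordinate_def)
  have shear: "F (\<lambda>r. ?p (y r)) = F y" if y: "cu (y 1) \<noteq> 0" for y
  proof -
    \<comment> \<open>The shear by this \<open>t\<close> moves the first vector onto the line of \<open>u\<close>.\<close>
    define t where "t = - cv (y 1) / cu (y 1)"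
    have "F (\<lambda>r. matrix_map 1 t 0 1 (y r)) = F y"
    proof (rule invariantsD(2)[OF F], rule matrix_map_Aut)
      show "1 * 1 - t * 0 \<noteq> 0" by simp
      show "matrix_map 1 t 0 1 (mul x y) = mul (matrix_map 1 t 0 1 x) (matrix_map 1 t 0 1 y)" for x y
        by (rule coords_eqI) (simp_all add: mult_table_coords[OF table] algebra_simps)
    qed
    moreover have "matrix_map 1 t 0 1 (y 1) = ?p (y 1)"
      using y by (intro coords_eqI) (simp_all add: t_def)
    ultimately show ?thesis using only by metis
  qed
  show "F (\<lambda>r. ?p (x r)) = F x"
  proof (cases "cu (x 1) = 0")
    case True
    let ?\<gamma> = "\<lambda>t r. x r + scl t u"
    have curve: "\<exists>P. \<forall>t. cu (?\<gamma> t r) = poly P t" "\<exists>P. \<forall>t. cv (?\<gamma> t r) = poly P t"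
      "\<exists>P. \<forall>t. cu (?p (?\<gamma> t r)) = poly P t" "\<exists>P. \<forall>t. cv (?p (?\<gamma> t r)) = poly P t" for r
      by (rule exI[of _ "[:cu (x r), 1:]"] exI[of _ "[:cv (x r):]"] exI[of _ 0], simp)+
    obtain P where P: "\<forall>t. F (?\<gamma> t) = poly P t"
      using polynomial_along_curve[where \<gamma> = ?\<gamma>, OF invariantsD(1)[OF F] curve(1,2)] by blast
    obtain Q where Q: "\<forall>t. F (\<lambda>r. ?p (?\<gamma> t r)) = poly Q t"
      using polynomial_along_curve[where \<gamma> = "\<lambda>t r. ?p (?\<gamma> t r)",
          OF invariantsD(1)[OF F] curve(3,4)] by blast
    have "F (\<lambda>r. ?p (?\<gamma> t r)) = F (?\<gamma> t)" if "t \<noteq> 0" for t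
      using True that by (intro shear) simp
    then have "poly (Q - P) 0 = 0"
      using P Q by (intro poly_const_off_zero) simp
    then have "F (?\<gamma> 0) = F (\<lambda>r. ?p (?\<gamma> 0 r))"
      using P[rule_format, of 0] Q[rule_format, of 0] by simp
    then show ?thesis by simp
  qed (rule shear)
qed

end


section \<open>Averaging over finite groups of automorphisms\<close>

context plane_algebra
begin

definition monom_fun :: "nat list \<Rightarrow> nat list \<Rightarrow> (nat \<Rightarrow> 'v) \<Rightarrow> 'a" where
  "monom_fun I J a = (\<Prod>r\<leftarrow>I. cu (a r)) * (\<Prod>r\<leftarrow>J. cv (a r))"

text \<open>
  Polynomial functions are spanned by monomials, so a linear operation that sends monomials
  into a linear space sends all polynomial functions there.
\<close>

inductive_set monomial_span :: "nat \<Rightarrow> ((nat \<Rightarrow> 'v) \<Rightarrow> 'a) set" for m where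
  monomial: "set I \<subseteq> {1..m} \<Longrightarrow> set J \<subseteq> {1..m} \<Longrightarrow> monom_fun I J \<in> monomial_span m"
| add: "f \<in> monomial_span m \<Longrightarrow> g \<in> monomial_span m \<Longrightarrow> (\<lambda>a. f a + g a) \<in> monomial_span m"
| scale: "f \<in> monomial_span m \<Longrightarrow> (\<lambda>a. k * f a) \<in> monomial_span m"

lemma monomial_span_mult:
  assumes "f \<in> monomial_span m" "g \<in> monomial_span m"
  shows "(\<lambda>a. f a * g a) \<in> monomial_span m"
  using assms(1)
proof induction
  case (monomial I J)
  show ?case
    using assms(2)
  proof induction
    case (monomial I' J')
    have "monom_fun (I @ I') (J @ J') \<in> monomial_span m"
      using monomial \<open>set I \<subseteq> {1..m}\<close> \<open>set J \<subseteq> {1..m}\<close> by (intro monomial_span.monomial) auto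
    moreover have "monom_fun (I @ I') (J @ J') = (\<lambda>a. monom_fun I J a * monom_fun I' J' a)"
      by (simp add: monom_fun_def fun_eq_iff mult_ac)
    ultimately show ?case by simp
  next
    case (add f g)
    then show ?case using monomial_span.add by (simp add: distrib_left)
  next
    case (scale f k)
    then show ?case using monomial_span.scale by (simp add: mult.left_commute)
  qed
next
  case (add f h)
  then show ?case using monomial_span.add by (simp add: distrib_right)
next
  case (scale f k)
  then show ?case using monomial_span.scale by (simp add: mult.assoc)
qed

lemma polynomial_functions_monomial_span:
  "polynomial_functions scl {u, v} m \<subseteq> monomial_span m"
proof
  fix F assume "F \<in> polynomial_functions scl {u, v} m"
  then show "F \<in> monomial_span m"
    unfolding polynomial_functions_coords
  proof induction
    case one
    show ?case
      using monomial_span.monomial[of "[]" m "[]"] by (simp add: monom_fun_def[abs_def])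
  next
    case (gen F)
    then obtain r where r: "r \<in> {1..m}" and "F = (\<lambda>a. cu (a r)) \<or> F = (\<lambda>a. cv (a r))" by blast
    moreover have "(\<lambda>a. cu (a r)) = monom_fun [r] []" "(\<lambda>a. cv (a r)) = monom_fun [] [r]"
      by (simp_all add: monom_fun_def fun_eq_iff)
    ultimately show ?case
      using monomial_span.monomial[of "[r]" m "[]"] monomial_span.monomial[of "[]" m "[r]"]
      by auto
  qed (auto intro: monomial_span.intros monomial_span_mult)
qed

end

context plane_algebra_char_0
begin

text \<open>
  Summing over the family multiplies an invariant by \<open>card N\<close>, which is invertible in
  characteristic zero, so the invariant is recovered from the corresponding sums of monomials.
\<close>

lemma invariants_subset_by_averaging:
  assumes "finite N" "N \<noteq> {}" "\<And>i. i \<in> N \<Longrightarrow> g i \<in> Aut scl mul"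
    and "\<And>I J. set I \<subseteq> {1..m} \<Longrightarrow> set J \<subseteq> {1..m} \<Longrightarrow>
      (\<lambda>a. \<Sum>i\<in>N. monom_fun I J (\<lambda>r. g i (a r))) \<in> generated_subalgebra G"
  shows "invariants scl {u, v} mul m \<subseteq> generated_subalgebra G"
proof
  fix F assume F: "F \<in> invariants scl {u, v} mul m"
  have "F \<in> monomial_span m"
    using invariantsD(1)[OF F] polynomial_functions_monomial_span by blast
  then have "(\<lambda>a. \<Sum>i\<in>N. F (\<lambda>r. g i (a r))) \<in> generated_subalgebra G"
    by induction
      (use assms(4) in \<open>auto simp: sum.distrib sum_distrib_left[symmetric]
        intro: generated_subalgebra.add generated_subalgebra.scale\<close>)
  moreover have "(\<Sum>i\<in>N. F (\<lambda>r. g i (a r))) = of_nat (card N) * F a" for a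
    using invariantsD(2)[OF F] assms(3) by simp
  ultimately have "(\<lambda>a. inverse (of_nat (card N)) * (of_nat (card N) * F a)) \<in> generated_subalgebra G"
    using generated_subalgebra.scale by simp
  moreover have "of_nat (card N) \<noteq> (0::'a)" using assms(1,2) by simp
  ultimately show "F \<in> generated_subalgebra G" by (simp add: mult.assoc[symmetric])
qed

text \<open>
  Under the reflection \<open>v \<mapsto> -v\<close> a monomial and its image add up to \<open>0\<close> or to twice the monomial,
  according to the parity of its degree in the \<open>v\<close>-coordinates; in the latter case these
  coordinates can be grouped in pairs.
\<close>

lemma invariants_subset_reflection:
  assumes g: "matrix_map 1 0 0 (-1) \<in> Aut scl mul"
  shows "invariants scl {u, v} mul m \<subseteq> generated_subalgebra
    ({\<lambda>a. cu (a r) | r. r \<in> {1..m}} \<union> {\<lambda>a. cv (a r) * cv (a s) | r s. r \<in> {1..m} \<and> s \<in> {1..m}})"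
    (is "_ \<subseteq> generated_subalgebra ?G")
proof (rule invariants_subset_by_averaging)
  define h where "h i = (if i then matrix_map 1 0 0 1 else matrix_map 1 0 0 (-1))" for i
  show "finite (UNIV :: bool set)" "(UNIV :: bool set) \<noteq> {}" by simp_all
  have "matrix_map 1 0 0 1 = id" by (intro ext coords_eqI) simp_all
  then have "matrix_map 1 0 0 1 \<in> Aut scl mul"
    using bij_id by (simp add: Aut_def algebra_iso_def linear_selfI id_def)
  then show "h i \<in> Aut scl mul" for i using g by (simp add: h_def)
  fix I J assume I: "set I \<subseteq> {1..m}" and J: "set J \<subseteq> {1..m}"
  have X: "(\<lambda>a. \<Prod>r\<leftarrow>I. cu (a r)) \<in> generated_subalgebra ?G"
    using I
  proof (induction I)
    case (Cons r I)
    then have "(\<lambda>a. cu (a r) * (\<Prod>r\<leftarrow>I. cu (a r))) \<in> generated_subalgebra ?G"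
      by (intro generated_subalgebra.mult[OF generated_subalgebra.gen]) auto
    then show ?case by simp
  qed (simp add: generated_subalgebra.one)
  have Y: "(\<lambda>a. \<Prod>r\<leftarrow>J. cv (a r)) \<in> generated_subalgebra ?G" if "even (length J)"
    using that J
  proof (induction J rule: induct_list012)
    case (3 r s J)
    then have "(\<lambda>a. (cv (a r) * cv (a s)) * (\<Prod>r\<leftarrow>J. cv (a r))) \<in> generated_subalgebra ?G"
      by (intro generated_subalgebra.mult[OF generated_subalgebra.gen]) auto
    then show ?case by (simp add: mult.assoc)
  qed (simp_all add: generated_subalgebra.one)
  have sgn: "(\<Prod>r\<leftarrow>J. - cv (a r)) = (-1) ^ length J * (\<Prod>r\<leftarrow>J. cv (a r))" for a :: "nat \<Rightarrow> 'v"
    by (induction J) auto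
  show "(\<lambda>a. \<Sum>i\<in>UNIV. monom_fun I J (\<lambda>r. h i (a r))) \<in> generated_subalgebra ?G"
  proof (cases "even (length J)")
    case True
    have "(\<lambda>a. 2 * ((\<Prod>r\<leftarrow>I. cu (a r)) * (\<Prod>r\<leftarrow>J. cv (a r)))) \<in> generated_subalgebra ?G"
      by (intro generated_subalgebra.scale generated_subalgebra.mult X Y True)
    then show ?thesis
      using True by (simp add: UNIV_bool h_def monom_fun_def sgn)
  next
    case False
    then show ?thesis
      by (simp add: UNIV_bool h_def monom_fun_def sgn generated_subalgebra_const)
  qed
qed

text \<open>
  With \<open>d \<noteq> 0\<close> the torus shrinks to the reflection \<open>v \<mapsto> -v\<close>, but the \<open>u\<close>-coordinate of
  a product \<open>x y\<close> now contains the term \<open>d\<close> times the product of the \<open>v\<close>-coordinates. A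
  trace that detects the \<open>u\<close>-coordinate therefore yields both kinds of generators.
\<close>

lemma equality_reflection:
  assumes table: "mult_table scl u v mul a 0 0 b 0 c d 0" and "d \<noteq> 0" "a + b \<noteq> 0 \<or> a + c \<noteq> 0"
  shows "invariants scl {u, v} mul m = trace_algebra scl {u, v} mul m"
proof (rule equality_of_generators[OF invariants_subset_reflection])
  show "matrix_map 1 0 0 (-1) \<in> Aut scl mul"
    by (rule matrix_map_Aut; (rule coords_eqI)?)
       (simp_all add: mult_table_coords[OF table] algebra_simps)
  let ?T = "trace_algebra scl {u, v} mul m"
  have L: "L_trace x = (a + b) * cu x" and R: "R_trace x = (a + c) * cu x" for x
    by (simp_all add: linear_trace_coords mult_table_coords[OF table] algebra_simps)
  have first: "(\<lambda>x. cu (x r)) \<in> ?T" if "r \<in> {1..m}" for r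
    by (rule trace_algebra_descale[OF letter_traces[OF that, unfolded L R] assms(3)])
  have second: "(\<lambda>x. cv (x r) * cv (x s)) \<in> ?T" if rs: "r \<in> {1..m}" "s \<in> {1..m}" for r s
  proof -
    have "(\<lambda>x. cu (mul (x r) (x s))) \<in> ?T"
      by (rule trace_algebra_descale[OF product_traces[OF rs, unfolded L R] assms(3)])
    moreover have "(\<lambda>x. a * (cu (x r) * cu (x s))) \<in> ?T"
      using first rs unfolding trace_algebra_def
      by (intro generated_subalgebra.scale generated_subalgebra.mult) auto
    ultimately have "(\<lambda>x. cu (mul (x r) (x s)) - a * (cu (x r) * cu (x s))) \<in> ?T"
      unfolding trace_algebra_def by (rule generated_subalgebra_diff)
    then have "(\<lambda>x. d * (cv (x r) * cv (x s))) \<in> ?T"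
      by (simp add: mult_table_coords[OF table] algebra_simps)
    then show ?thesis using \<open>d \<noteq> 0\<close> by (auto intro: trace_algebra_descale)
  qed
  show "{\<lambda>a. cu (a r) | r. r \<in> {1..m}} \<union>
      {\<lambda>a. cv (a r) * cv (a s) | r s. r \<in> {1..m} \<and> s \<in> {1..m}} \<subseteq> ?T"
    using first second by auto
qed

end


section \<open>The algebra whose automorphism group is the symmetric group\<close>

text \<open>
  The remaining algebra, \<open>u u = v\<close>, \<open>v v = u\<close>, \<open>u v = v u = 0\<close>, has trace-free left and right
  multiplications. Its automorphisms are generated by the swap of \<open>u\<close> and \<open>v\<close> and by
  \<open>u \<mapsto> \<omega> u\<close>, \<open>v \<mapsto> \<omega>\<^sup>2 v\<close> for a primitive cube root of unity \<open>\<omega>\<close>: this is the reflection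
  representation of the symmetric group on three letters. Averaging reduces the invariants
  to sums \<open>M + M'\<close>, where \<open>M\<close> is a monomial invariant under the rotations and \<open>M'\<close> its image
  under the swap. Such an \<open>M\<close> is a product of the monomials \<open>x\<^sub>r y\<^sub>s\<close>, \<open>x\<^sub>r x\<^sub>s x\<^sub>t\<close> and
  \<open>y\<^sub>r y\<^sub>s y\<^sub>t\<close> in the coordinates, and the identity
  \<open>2 (A C + A' C') = (A + A') (C + C') + (A - A') (C - C')\<close>
  breaks it into its factors, provided that products of two skew functions are under control.
\<close>

locale S3_algebra = plane_algebra_char_0 scl u v mul
  for scl :: "'a::field_char_0 \<Rightarrow> 'v::ab_group_add \<Rightarrow> 'v" and u v :: 'v and mul +
  fixes m :: nat
  assumes table: "mult_table scl u v mul 0 1 0 0 0 0 1 0"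
begin

lemma mul_S3 [simp]: "cu (mul x y) = cv x * cv y" "cv (mul x y) = cu x * cu y"
  by (simp_all add: mult_table_coords[OF table])

definition pairing :: "nat \<Rightarrow> nat \<Rightarrow> (nat \<Rightarrow> 'v) \<Rightarrow> 'a" where
  "pairing r s a = cu (a r) * cv (a s) + cv (a r) * cu (a s)"
definition cubic :: "nat \<Rightarrow> nat \<Rightarrow> nat \<Rightarrow> (nat \<Rightarrow> 'v) \<Rightarrow> 'a" where
  "cubic r s t a = cu (a r) * cu (a s) * cu (a t) + cv (a r) * cv (a s) * cv (a t)"
definition skew_pairing :: "nat \<Rightarrow> nat \<Rightarrow> (nat \<Rightarrow> 'v) \<Rightarrow> 'a" where
  "skew_pairing r s a = cu (a r) * cv (a s) - cv (a r) * cu (a s)"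
definition skew_cubic :: "nat \<Rightarrow> nat \<Rightarrow> nat \<Rightarrow> (nat \<Rightarrow> 'v) \<Rightarrow> 'a" where
  "skew_cubic r s t a = cu (a r) * cu (a s) * cu (a t) - cv (a r) * cv (a s) * cv (a t)"

definition S3_generators :: "((nat \<Rightarrow> 'v) \<Rightarrow> 'a) set" where
  "S3_generators = {pairing r s | r s. {r, s} \<subseteq> {1..m}} \<union>
     {cubic r s t | r s t. {r, s, t} \<subseteq> {1..m}}"

abbreviation S3_span :: "((nat \<Rightarrow> 'v) \<Rightarrow> 'a) set" where
  "S3_span \<equiv> generated_subalgebra S3_generators"

definition skew :: "((nat \<Rightarrow> 'v) \<Rightarrow> 'a) set" where
  "skew = {skew_pairing r s | r s. {r, s} \<subseteq> {1..m}} \<union>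
     {skew_cubic r s t | r s t. {r, s, t} \<subseteq> {1..m}}"

lemma S3_span_pairing: "{r, s} \<subseteq> {1..m} \<Longrightarrow> pairing r s \<in> S3_span"
  and S3_span_cubic: "{r, s, t} \<subseteq> {1..m} \<Longrightarrow> cubic r s t \<in> S3_span"
  unfolding S3_generators_def by (rule generated_subalgebra.gen, blast)+

lemma skew_pairing_in_skew: "{r, s} \<subseteq> {1..m} \<Longrightarrow> skew_pairing r s \<in> skew"
  and skew_cubic_in_skew: "{r, s, t} \<subseteq> {1..m} \<Longrightarrow> skew_cubic r s t \<in> skew"
  unfolding skew_def by blast+

lemmas S3_span_intros = S3_span_pairing S3_span_cubic
  generated_subalgebra.add generated_subalgebra_diff generated_subalgebra.mult

text \<open>
  Three identities show that a product of two skew generators is a polynomial in the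
  invariant ones. The first is the Gram determinant of the pairing.
\<close>

lemma skew_pairing_mult_skew_pairing:
  assumes "{r, s, t, w} \<subseteq> {1..m}"
  shows "(\<lambda>a. skew_pairing r s a * skew_pairing t w a) \<in> S3_span"
proof -
  have "(\<lambda>a. skew_pairing r s a * skew_pairing t w a)
      = (\<lambda>a. pairing r w a * pairing s t a - pairing r t a * pairing s w a)"
    by (simp add: fun_eq_iff skew_pairing_def pairing_def algebra_simps)
  also have "\<dots> \<in> S3_span" using assms by (intro S3_span_intros) auto
  finally show ?thesis .
qed

lemma skew_pairing_mult_skew_cubic:
  assumes "{r, s, i, j, k} \<subseteq> {1..m}"
  shows "(\<lambda>a. skew_pairing r s a * skew_cubic i j k a) \<in> S3_span"
proof -
  have "(\<lambda>a. skew_pairing r s a * skew_cubic i j k a)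
      = (\<lambda>a. cubic r i j a * pairing s k a - cubic s i j a * pairing r k a)"
    by (simp add: fun_eq_iff skew_pairing_def pairing_def cubic_def skew_cubic_def algebra_simps)
  also have "\<dots> \<in> S3_span" using assms by (intro S3_span_intros) auto
  finally show ?thesis .
qed

text \<open>
  Write \<open>X\<close>, \<open>Y\<close> for the products of the \<open>u\<close>- and \<open>v\<close>-coordinates of \<open>r\<close>, \<open>s\<close>, \<open>t\<close>, and
  \<open>X'\<close>, \<open>Y'\<close> for those of \<open>i\<close>, \<open>j\<close>, \<open>k\<close>. Then
  \<open>(X - Y) (X' - Y') = (X + Y) (X' + Y') - 2 (X Y' + Y X')\<close>. Here \<open>X Y'\<close> is a product of three
  factors of the form \<open>x\<^sub>r y\<^sub>i\<close>, and \<open>X Y' + Y X'\<close> is expanded into symmetric and skew parts of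
  these factors; only terms with an even number of skew parts survive.
\<close>

lemma skew_cubic_mult_skew_cubic:
  assumes "{r, s, t, i, j, k} \<subseteq> {1..m}"
  shows "(\<lambda>a. skew_cubic r s t a * skew_cubic i j k a) \<in> S3_span"
proof -
  have "(\<lambda>a. skew_cubic r s t a * skew_cubic i j k a) =
    (\<lambda>a. cubic r s t a * cubic i j k a - (1 / 2) * (
        pairing r i a * pairing s j a * pairing t k a
      + pairing r i a * (skew_pairing s j a * skew_pairing t k a)
      + (skew_pairing r i a * skew_pairing t k a) * pairing s j a
      + (skew_pairing r i a * skew_pairing s j a) * pairing t k a))"
    by (simp add: fun_eq_iff skew_pairing_def pairing_def cubic_def skew_cubic_def field_simps)
  also have "\<dots> \<in> S3_span"
    using assms
    by (intro S3_span_intros generated_subalgebra.scale skew_pairing_mult_skew_pairing) auto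
  finally show ?thesis .
qed

lemma skew_mult_skew:
  assumes "D \<in> skew" "D' \<in> skew"
  shows "(\<lambda>a. D a * D' a) \<in> S3_span"
proof -
  have comm: "(\<lambda>a. D' a * D a) \<in> S3_span \<Longrightarrow> (\<lambda>a. D a * D' a) \<in> S3_span"
    by (simp add: mult.commute)
  show ?thesis
    using assms comm unfolding skew_def
    by (elim UnE CollectE exE conjE)
       (simp_all add: skew_pairing_mult_skew_pairing skew_pairing_mult_skew_cubic
         skew_cubic_mult_skew_cubic)
qed

text \<open>
  The induction hypothesis for \<open>M\<close> and its swapped image: the symmetric part is generated, and
  so is every product of the skew part with a skew generator. The second half is what lets the
  first survive multiplication by one more factor.
\<close>

definition balanced :: "((nat \<Rightarrow> 'v) \<Rightarrow> 'a) \<Rightarrow> ((nat \<Rightarrow> 'v) \<Rightarrow> 'a) \<Rightarrow> bool" where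
  "balanced A A' \<longleftrightarrow> (\<lambda>a. A a + A' a) \<in> S3_span \<and> (\<forall>D\<in>skew. (\<lambda>a. (A a - A' a) * D a) \<in> S3_span)"

lemma balanced_sym: "balanced A A' \<Longrightarrow> balanced A' A"
proof -
  assume A: "balanced A A'"
  have "(\<lambda>a. (A' a - A a) * D a) \<in> S3_span" if "D \<in> skew" for D
  proof -
    have "(\<lambda>a. (-1) * ((A a - A' a) * D a)) \<in> S3_span"
      using A that by (intro generated_subalgebra.scale) (simp add: balanced_def)
    then show ?thesis by (simp add: algebra_simps)
  qed
  then show "balanced A' A" using A by (simp add: balanced_def add.commute)
qed

lemma balanced_mult:
  assumes A: "balanced A A'" and sum: "(\<lambda>a. C a + C' a) \<in> S3_span" and diff: "(\<lambda>a. C a - C' a) \<in> skew"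
  shows "balanced (\<lambda>a. C a * A a) (\<lambda>a. C' a * A' a)"
proof -
  have As: "(\<lambda>a. A a + A' a) \<in> S3_span" and Ad: "\<And>D. D \<in> skew \<Longrightarrow> (\<lambda>a. (A a - A' a) * D a) \<in> S3_span"
    using A by (simp_all add: balanced_def)
  have "(\<lambda>a. C a * A a + C' a * A' a)
      = (\<lambda>a. (1 / 2) * ((C a + C' a) * (A a + A' a) + (A a - A' a) * (C a - C' a)))"
    by (simp add: fun_eq_iff field_simps)
  also have "\<dots> \<in> S3_span"
    by (intro generated_subalgebra.scale generated_subalgebra.add generated_subalgebra.mult
        sum As Ad diff)
  finally have sum': "(\<lambda>a. C a * A a + C' a * A' a) \<in> S3_span" .
  have diff': "(\<lambda>a. (C a * A a - C' a * A' a) * D a) \<in> S3_span" if D: "D \<in> skew" for D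
  proof -
    have "(\<lambda>a. (C a * A a - C' a * A' a) * D a)
        = (\<lambda>a. (1 / 2) * ((C a + C' a) * ((A a - A' a) * D a)
          + (A a + A' a) * ((C a - C' a) * D a)))"
      by (simp add: fun_eq_iff field_simps)
    also have "\<dots> \<in> S3_span"
      by (intro generated_subalgebra.scale generated_subalgebra.add
          generated_subalgebra.mult[OF sum Ad[OF D]]
          generated_subalgebra.mult[OF As skew_mult_skew[OF diff D]])
    finally show ?thesis .
  qed
  show ?thesis using sum' diff' by (simp add: balanced_def)
qed

text \<open>
  The divisibility condition says that the monomial is invariant under the rotations. Such a
  monomial contains a factor \<open>x\<^sub>r y\<^sub>s\<close>, or else it is a pure monomial of degree divisible by
  three.
\<close>

lemma balanced_monomials:
  assumes "set I \<subseteq> {1..m}" "set J \<subseteq> {1..m}" "3 dvd length I + 2 * length J"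
  shows "balanced (monom_fun I J) (monom_fun J I)"
  using assms
proof (induction "length I + length J" arbitrary: I J rule: less_induct)
  case less
  have cubes: "balanced (monom_fun K []) (monom_fun [] K)"
    if K: "set K \<subseteq> {1..m}" "3 dvd length K" "length K = length I + length J" for K
  proof (cases K)
    case Nil
    have "(\<lambda>a. 1 + 1) \<in> S3_span" "(\<lambda>a. (0::'a)) \<in> S3_span"
      by (intro generated_subalgebra.add generated_subalgebra.one generated_subalgebra_const)+
    then show ?thesis by (simp add: Nil balanced_def monom_fun_def)
  next
    case (Cons r K')
    then have "3 \<le> length K" using K(2) by (intro dvd_imp_le) auto
    then obtain r s t K'' where K'': "K = r # s # t # K''"
      by (auto simp: numeral_3_eq_3 Suc_le_length_iff)
    have "3 dvd length K''" using K(2) unfolding K'' by simp presburger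
    then have "balanced (monom_fun K'' []) (monom_fun [] K'')"
      using K K'' by (intro less.hyps) auto
    then have "balanced (\<lambda>a. cu (a r) * cu (a s) * cu (a t) * monom_fun K'' [] a)
        (\<lambda>a. cv (a r) * cv (a s) * cv (a t) * monom_fun [] K'' a)"
    proof (rule balanced_mult)
      show "(\<lambda>a. cu (a r) * cu (a s) * cu (a t) + cv (a r) * cv (a s) * cv (a t)) \<in> S3_span"
        using S3_span_cubic[of r s t] K K'' by (simp add: cubic_def[abs_def])
      show "(\<lambda>a. cu (a r) * cu (a s) * cu (a t) - cv (a r) * cv (a s) * cv (a t)) \<in> skew"
        using skew_cubic_in_skew[of r s t] K K'' by (simp add: skew_cubic_def[abs_def])
    qed
    then show ?thesis by (simp add: K'' monom_fun_def[abs_def] mult_ac)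
  qed
  show ?case
  proof (cases I)
    case Nil
    have "3 dvd length J" using less.prems(3) Nil by (simp add: coprime_dvd_mult_right_iff)
    then show ?thesis using Nil less.prems by (intro balanced_sym[OF cubes, of J, folded Nil]) auto
  next
    case (Cons r I')
    show ?thesis
    proof (cases J)
      case Nil
      then show ?thesis using less.prems cubes[of I] by simp
    next
      case (Cons s J')
      have "3 dvd length I' + 2 * length J'"
        using less.prems(3) unfolding \<open>I = r # I'\<close> Cons by simp presburger
      then have "balanced (monom_fun I' J') (monom_fun J' I')"
        using less.prems \<open>I = r # I'\<close> Cons by (intro less.hyps) auto
      then have "balanced (\<lambda>a. cu (a r) * cv (a s) * monom_fun I' J' a)
          (\<lambda>a. cv (a r) * cu (a s) * monom_fun J' I' a)"
      proof (rule balanced_mult)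
        show "(\<lambda>a. cu (a r) * cv (a s) + cv (a r) * cu (a s)) \<in> S3_span"
          using S3_span_pairing[of r s] less.prems \<open>I = r # I'\<close> Cons by (simp add: pairing_def[abs_def])
        show "(\<lambda>a. cu (a r) * cv (a s) - cv (a r) * cu (a s)) \<in> skew"
          using skew_pairing_in_skew[of r s] less.prems \<open>I = r # I'\<close> Cons
          by (simp add: skew_pairing_def[abs_def])
      qed
      then show ?thesis by (simp add: \<open>I = r # I'\<close> Cons monom_fun_def[abs_def] mult_ac)
    qed
  qed
qed

text \<open>
  The pairing is the trace form of the left multiplications, the cubic form is the trace of
  left multiplication by \<open>x y\<close> after left multiplication by \<open>z\<close>.
\<close>

lemma S3_generators_traces: "S3_generators \<subseteq> trace_algebra scl {u, v} mul m"
proof -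
  have "pairing r s \<in> trace_algebra scl {u, v} mul m" if "{r, s} \<subseteq> {1..m}" for r s
    using composed_traces(1)[of r m s r] that
    by (simp add: linear_trace_coords pairing_def[abs_def] add.commute)
  moreover have "cubic r s t \<in> trace_algebra scl {u, v} mul m" if "{r, s, t} \<subseteq> {1..m}" for r s t
    using composed_traces(2)[of r m s t] that
    by (simp add: linear_trace_coords cubic_def[abs_def] add.commute)
  ultimately show ?thesis unfolding S3_generators_def by blast
qed

lemma invariants_subset_S3_span:
  fixes \<omega> :: 'a
  assumes \<omega>: "\<omega>\<^sup>2 + \<omega> + 1 = 0"
  shows "invariants scl {u, v} mul m \<subseteq> S3_span"
proof (rule invariants_subset_by_averaging)
  let ?N = "{..<3::nat} \<times> (UNIV :: bool set)"
  \<comment> \<open>The three rotations and the three reflections.\<close>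
  define g where "g i = (case i of (k, swap) \<Rightarrow>
    if swap then matrix_map 0 (\<omega> ^ k) ((\<omega> ^ k)\<^sup>2) 0 else matrix_map (\<omega> ^ k) 0 0 ((\<omega> ^ k)\<^sup>2))"
    for i :: "nat \<times> bool"
  show "finite ?N" "?N \<noteq> {}" by (simp_all add: lessThan_Suc numeral_3_eq_3)
  have "(\<omega> - 1) * (\<omega>\<^sup>2 + \<omega> + 1) = \<omega> ^ 3 - 1"
    by (simp add: algebra_simps power2_eq_square power3_eq_cube)
  then have cube: "\<omega> ^ 3 = 1" using \<omega> by simp
  show "g i \<in> Aut scl mul" for i
  proof (cases i)
    case (Pair k swap)
    define z where "z = \<omega> ^ k"
    have "z ^ 3 = 1" unfolding z_def by (metis cube power_commutes power_mult power_one mult.commute)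
    then have z: "z * (z * z) = 1" by (simp add: power3_eq_cube mult.assoc)
    then have "z \<noteq> 0" by auto
    show ?thesis
      using \<open>z \<noteq> 0\<close>
      by (cases swap; simp add: Pair g_def z_def[symmetric]; intro matrix_map_Aut coords_eqI)
         (simp_all add: power2_eq_square mult_ac z)
  qed
  fix I J assume IJ: "set I \<subseteq> {1..m}" "set J \<subseteq> {1..m}"
  \<comment> \<open>The weights, under the rotation, of the monomial and of its image under the swap.\<close>
  define e e' where "e = \<omega> ^ (length I + 2 * length J)" and "e' = \<omega> ^ (2 * length I + length J)"
  have scaled: "(\<Prod>r\<leftarrow>K. z * X (a r)) = z ^ length K * (\<Prod>r\<leftarrow>K. X (a r))"
    for K z and X :: "'v \<Rightarrow> 'a" and a :: "nat \<Rightarrow> 'v"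
    by (induction K) (auto simp: mult_ac)
  have pow: "(\<omega> ^ k) ^ length I * ((\<omega> ^ k)\<^sup>2) ^ length J = e ^ k"
    "((\<omega> ^ k)\<^sup>2) ^ length I * (\<omega> ^ k) ^ length J = e' ^ k" for k
    by (simp_all add: e_def e'_def power_mult[symmetric] power_add[symmetric] algebra_simps)
  have rot: "monom_fun I J (\<lambda>r. g (k, False) (a r)) = e ^ k * monom_fun I J a" for k a
    unfolding pow(1)[symmetric] by (simp add: g_def monom_fun_def scaled)
  have refl: "monom_fun I J (\<lambda>r. g (k, True) (a r)) = e' ^ k * monom_fun J I a" for k a
    unfolding pow(2)[symmetric] by (simp add: g_def monom_fun_def scaled)
  have "(\<lambda>a. \<Sum>i\<in>?N. monom_fun I J (\<lambda>r. g i (a r)))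
      = (\<lambda>a. (\<Sum>k<3. e ^ k) * monom_fun I J a + (\<Sum>k<3. e' ^ k) * monom_fun J I a)"
    by (simp add: sum.cartesian_product' UNIV_bool rot refl sum.distrib sum_distrib_right)
  also have "\<dots> \<in> S3_span"
  proof (cases "3 dvd length I + 2 * length J")
    case True
    then have "3 dvd 2 * length I + length J" by presburger
    with True have "e = 1" "e' = 1" unfolding e_def e'_def by (auto simp: dvd_def power_mult cube)
    moreover have "(\<lambda>a. 3 * (monom_fun I J a + monom_fun J I a)) \<in> S3_span"
      using balanced_monomials[OF IJ True]
      by (intro generated_subalgebra.scale) (simp add: balanced_def)
    ultimately show ?thesis by (simp add: distrib_left)
  next
    case False
    have zero: "(\<Sum>k<3. (\<omega> ^ n) ^ k) = 0" if "\<not> 3 dvd n" for n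
    proof -
      have "\<omega> ^ n = \<omega> ^ (n mod 3)"
        by (metis cube div_mult_mod_eq power_add power_mult power_one mult.commute mult_1)
      moreover have "n mod 3 = 1 \<or> n mod 3 = 2" using that by presburger
      moreover have "(\<Sum>k<3. x ^ k) = 1 + x + x\<^sup>2" for x :: 'a
        by (simp add: numeral_3_eq_3 power2_eq_square)
      moreover have "1 + \<omega> + \<omega>\<^sup>2 = 0" using \<omega> by (simp add: algebra_simps)
      moreover have "1 + \<omega>\<^sup>2 + (\<omega>\<^sup>2)\<^sup>2 = (\<omega>\<^sup>2 + \<omega> + 1) * (\<omega>\<^sup>2 - \<omega> + 1)"
        by (simp add: algebra_simps power2_eq_square)
      ultimately show ?thesis using \<omega> by auto
    qed
    have "\<not> 3 dvd 2 * length I + length J" using False by presburger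
    then show ?thesis using False
      by (simp add: e_def e'_def zero generated_subalgebra_const)
  qed
  finally show "(\<lambda>a. \<Sum>i\<in>?N. monom_fun I J (\<lambda>r. g i (a r))) \<in> S3_span" .
qed

lemma equality_S3:
  fixes \<omega> :: 'a
  assumes "\<omega>\<^sup>2 + \<omega> + 1 = 0"
  shows "invariants scl {u, v} mul m = trace_algebra scl {u, v} mul m"
  using equality_of_generators[OF invariants_subset_S3_span[OF assms] S3_generators_traces] .

end


section \<open>Invariants that are not operator traces\<close>

context plane_algebra
begin

lemma operator_trace_coords:
  "operator_trace scl {u, v} mul h a =
    (\<Sum>w\<in>Poly_Mapping.keys h. Poly_Mapping.lookup h w *
      (cu (monomial_subst mul (a(0 := u)) w) + cv (monomial_subst mul (a(0 := v)) w)))"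
proof -
  have sums: "cu (\<Sum>i\<in>N. f i) = (\<Sum>i\<in>N. cu (f i))" "cv (\<Sum>i\<in>N. f i) = (\<Sum>i\<in>N. cv (f i))"
    for N :: "nat nonassoc_word option set" and f
    by (simp_all add: cu_def cv_def representation_Basis_sum)
  show ?thesis
    by (simp add: operator_trace_def linear_trace_coords free_subst_def sums distrib_left
        sum.distrib)
qed

lemma AutD:
  assumes "g \<in> Aut scl mul"
  shows "Vector_Spaces.linear scl scl g" "inj g" "g (mul x y) = mul (g x) (g y)"
  using assms by (auto simp: Aut_def algebra_iso_def bij_is_inj)

text \<open>
  In the tables treated here the line of \<open>v\<close> is an ideal, and it is annihilated by itself.
  An operator \<open>h(-, a)\<close> is therefore triangular with diagonal entries that depend only on the
  classes of the vectors \<open>a\<^sub>r\<close> modulo this line, and the same holds for its trace.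
\<close>

lemma shear_word_coords:
  assumes table: "mult_table scl u v mul (b + c) k 0 b 0 c 0 0"
    and eq: "\<And>r. cu (s r) = cu (s' r)"
  shows "cu (word_subst mul s w) = cu (word_subst mul s' w)"
  by (induction w) (simp_all add: eq mult_table_coords[OF table])

lemma shear_word_kernel:
  assumes table: "mult_table scl u v mul (b + c) k 0 b 0 c 0 0"
    and eq: "\<And>r. cu (s r) = cu (s' r)" and deg: "word_degree 0 w = 1"
  shows "cu (word_subst mul (s(0 := v)) w) = 0 \<and>
    word_subst mul (s(0 := v)) w = word_subst mul (s'(0 := v)) w"
  using deg
proof (induction w)
  case (Letter x)
  then show ?case by (simp split: if_splits)
next
  case (Prod x y)
  note coords = mult_table_coords[OF table]
  have cu: "cu (word_subst mul s w) = cu (word_subst mul s' w)" for w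
    by (rule shear_word_coords[OF table eq])
  show ?case
  proof (cases "word_degree 0 x = 0")
    case True
    then have "word_degree 0 y = 1" using Prod.prems by simp
    note IH = Prod.IH(2)[OF this]
    then have IH': "cu (word_subst mul (s'(0 := v)) y) = 0" by metis
    have "mul (word_subst mul s x) z = mul (word_subst mul s' x) z" if "cu z = 0" for z
      using that cu[of x] by (intro coords_eqI) (simp_all add: coords)
    with IH IH' True show ?thesis by (simp add: word_subst_fun_upd coords del: fun_upd_apply)
  next
    case False
    then have deg: "word_degree 0 x = 1" "word_degree 0 y = 0" using Prod.prems by simp_all
    note IH = Prod.IH(1)[OF deg(1)]
    then have IH': "cu (word_subst mul (s'(0 := v)) x) = 0" by metis
    have "mul z (word_subst mul s y) = mul z (word_subst mul s' y)" if "cu z = 0" for z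
      using that cu[of y] by (intro coords_eqI) (simp_all add: coords)
    with IH IH' deg(2) show ?thesis by (simp add: word_subst_fun_upd coords del: fun_upd_apply)
  qed
qed

lemma shear_operator_trace:
  assumes table: "mult_table scl u v mul (b + c) k 0 b 0 c 0 0"
    and eq: "\<And>r. cu (s r) = cu (s' r)" and h: "h \<in> operator_polynomials m"
  shows "operator_trace scl {u, v} mul h s = operator_trace scl {u, v} mul h s'"
  unfolding operator_trace_coords
proof (intro sum.cong refl arg_cong2[of _ _ _ _ "(*)"] arg_cong2[of _ _ _ _ "(+)"])
  fix w assume w: "w \<in> Poly_Mapping.keys h"
  obtain x where x: "w = Some x" "word_degree 0 x = 1"
    using operator_polynomials_keys[OF h w] by blast
  show "cu (monomial_subst mul (s(0 := u)) w) = cu (monomial_subst mul (s'(0 := u)) w)"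
    using shear_word_coords[OF table, of "s(0 := u)" "s'(0 := u)" x] eq
    by (simp add: x monomial_subst_def)
  show "cv (monomial_subst mul (s(0 := v)) w) = cv (monomial_subst mul (s'(0 := v)) w)"
    using shear_word_kernel[OF table eq x(2)] by (simp add: x monomial_subst_def)
qed

lemma shear_trace_algebra:
  assumes table: "mult_table scl u v mul (b + c) k 0 b 0 c 0 0"
    and eq: "\<And>r. cu (s r) = cu (s' r)" and F: "F \<in> trace_algebra scl {u, v} mul m"
  shows "F s = F s'"
  using F unfolding trace_algebra_def
  by induction (auto simp: shear_operator_trace[OF table eq])

text \<open>
  Every automorphism has determinant one: it preserves the line of \<open>v\<close>, and the products
  \<open>u v\<close>, \<open>v u\<close> and \<open>u u\<close> force its two eigenvalues to be one.
\<close>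

lemma shear_Aut:
  assumes table: "mult_table scl u v mul (b + c) k 0 b 0 c 0 0"
    and nonzero: "k \<noteq> 0" "b \<noteq> 0 \<or> c \<noteq> 0" and g: "g \<in> Aut scl mul"
  shows "cu (g u) = 1 \<and> cu (g v) = 0 \<and> cv (g v) = 1"
proof -
  note coords = mult_table_coords[OF table] and lin = linear_coords[OF AutD(1)[OF g]]
  note lin_mul = lin[of "mul x y" for x y]
  define p q r s where "p = cu (g u)" and "q = cv (g u)" and "r = cu (g v)" and "s = cv (g v)"
  note pqrs = p_def[symmetric] q_def[symmetric] r_def[symmetric] s_def[symmetric]
  have hom: "cu (g (mul x y)) = cu (mul (g x) (g y))" "cv (g (mul x y)) = cv (mul (g x) (g y))" for x y
    by (simp_all add: AutD(3)[OF g])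
  have vv: "(b + c) * r * r = 0" "k * r * r + (b + c) * r * s = 0"
    using hom[of v v] by (simp_all add: lin_mul coords pqrs algebra_simps)
  have r: "r = 0" using vv nonzero(1) by (cases "b + c = 0") auto
  have "s \<noteq> 0"
  proof
    assume "s = 0"
    with r have "g v = g 0" by (intro coords_eqI) (simp_all add: r_def s_def lin[of 0])
    then show False using AutD(2)[OF g] coords_basis coords_zero by (metis injD zero_neq_one)
  qed
  have "b * s = p * (b * s)" "c * s = p * (c * s)"
    using hom[of u v] hom[of v u] by (simp_all add: lin_mul coords pqrs r algebra_simps)
  with \<open>s \<noteq> 0\<close> nonzero(2) have p: "p = 1" by auto
  have "k * s = k" using hom(2)[of u u] by (simp add: lin_mul coords pqrs r p algebra_simps)
  then have "s = 1" using nonzero(1) by simp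
  with r p show ?thesis by (simp add: pqrs)
qed

text \<open>
  The determinant of two vectors is an invariant that is not a function of the
  \<open>u\<close>-coordinates.
\<close>

lemma inequality_shear:
  assumes table: "mult_table scl u v mul (b + c) k 0 b 0 c 0 0"
    and nonzero: "k \<noteq> 0" "b \<noteq> 0 \<or> c \<noteq> 0" and m: "m > 1"
  shows "invariants scl {u, v} mul m \<noteq> trace_algebra scl {u, v} mul m"
proof
  assume eq: "invariants scl {u, v} mul m = trace_algebra scl {u, v} mul m"
  define F where "F a = cu (a 1) * cv (a 2) - cv (a 1) * cu (a 2)" for a :: "nat \<Rightarrow> 'v"
  have "F \<in> polynomial_functions scl {u, v} m"
  proof -
    have "(\<lambda>a. cu (a r)) \<in> polynomial_functions scl {u, v} m"
      "(\<lambda>a. cv (a r)) \<in> polynomial_functions scl {u, v} m" if "r \<in> {1, 2}" for r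
      using coordinate_in_polynomial_functions[of r m u] coordinate_in_polynomial_functions[of r m v]
        that m by (auto simp: cu_def cv_def)
    then show ?thesis
      unfolding F_def[abs_def] polynomial_functions_def
      by (intro generated_subalgebra_diff generated_subalgebra.mult) blast+
  qed
  moreover have "F (\<lambda>r. g (a r)) = F a" if g: "g \<in> Aut scl mul" for g a
    using shear_Aut[OF table nonzero g]
    by (simp add: F_def linear_coords[OF AutD(1)[OF g], of "a r" for r] algebra_simps)
  ultimately have "F \<in> trace_algebra scl {u, v} mul m"
    unfolding eq[symmetric] by (simp add: invariants_def)
  \<comment> \<open>Two points with equal \<open>u\<close>-coordinates, where the determinant is \<open>1\<close> and \<open>0\<close>.\<close>
  then have "F ((\<lambda>_. 0)(1 := u, 2 := v)) = F ((\<lambda>_. 0)(1 := u))"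
    by (rule shear_trace_algebra[OF table, rotated]) simp
  then show False by (simp add: F_def)
qed

text \<open>
  On points all of whose entries are \<open>t u\<close> every operator is diagonal. Each multiplication on
  the way from \<open>\<chi>\<^sub>0\<close> to the whole word changes the sign of the eigenvalue at \<open>v\<close> and
  contributes a positive power of \<open>t\<close>. So words linear in \<open>t\<close> come from exactly one
  multiplication, and the two eigenvalues of such a word cancel in the trace.
\<close>

lemma D2_word:
  fixes w :: "nat nonassoc_word"
  assumes table: "mult_table scl u v mul 1 0 0 (-1) 0 (-1) 0 0" and deg: "word_degree 0 w = 1"
  shows "\<exists>n \<epsilon>. (\<forall>t. word_subst mul ((\<lambda>_. scl t u)(0 := u)) w = scl (t ^ n) u \<and>
      word_subst mul ((\<lambda>_. scl t u)(0 := v)) w = scl (\<epsilon> * t ^ n) v) \<and>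
    (n = 0 \<and> \<epsilon> = 1 \<or> n = 1 \<and> \<epsilon> = -1 \<or> n \<ge> 2)"
  using deg
proof (induction w)
  case (Letter x)
  then show ?case by (intro exI[of _ 0] exI[of _ 1]) (simp split: if_splits)
next
  case (Prod x y)
  note coords = mult_table_coords[OF table]
  have const: "\<exists>k. k \<ge> 1 \<and> (\<forall>t. word_subst mul (\<lambda>_. scl t u) w = scl (t ^ k) u)"
    for w :: "nat nonassoc_word"
  proof (induction w)
    case (Letter x)
    show ?case by (rule exI[of _ 1]) simp
  next
    case (Prod x y)
    then obtain k l where "k \<ge> 1" "l \<ge> 1" "\<And>t. word_subst mul (\<lambda>_. scl t u) x = scl (t ^ k) u"
      "\<And>t. word_subst mul (\<lambda>_. scl t u) y = scl (t ^ l) u" by blast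
    then show ?case
      by (intro exI[of _ "k + l"]) (auto intro!: coords_eqI simp: coords power_add)
  qed
  have sym: "mul x y = mul y x" for x y
    by (rule coords_eqI) (simp_all add: coords)
  have step: ?case
    if W: "\<And>b t. word_subst mul ((\<lambda>_. scl t u)(0 := b)) (Prod x y)
        = mul (word_subst mul ((\<lambda>_. scl t u)(0 := b)) z) (word_subst mul (\<lambda>_. scl t u) z')"
      and IH: "\<exists>n \<epsilon>. (\<forall>t. word_subst mul ((\<lambda>_. scl t u)(0 := u)) z = scl (t ^ n) u \<and>
        word_subst mul ((\<lambda>_. scl t u)(0 := v)) z = scl (\<epsilon> * t ^ n) v) \<and>
        (n = 0 \<and> \<epsilon> = 1 \<or> n = 1 \<and> \<epsilon> = -1 \<or> n \<ge> 2)" for z z' :: "nat nonassoc_word"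
  proof -
    obtain n \<epsilon> where vals: "\<And>t. word_subst mul ((\<lambda>_. scl t u)(0 := u)) z = scl (t ^ n) u"
      "\<And>t. word_subst mul ((\<lambda>_. scl t u)(0 := v)) z = scl (\<epsilon> * t ^ n) v"
      and n: "n = 0 \<and> \<epsilon> = 1 \<or> n = 1 \<and> \<epsilon> = -1 \<or> n \<ge> 2"
      using IH by blast
    obtain k where k: "k \<ge> 1" "\<And>t. word_subst mul (\<lambda>_. scl t u) z' = scl (t ^ k) u"
      using const[of z'] by blast
    show ?thesis
    proof (intro exI conjI allI)
      show "word_subst mul ((\<lambda>_. scl t u)(0 := u)) (Prod x y) = scl (t ^ (n + k)) u" for t
        by (rule coords_eqI) (simp_all add: W vals k(2) coords power_add del: word_subst.simps fun_upd_apply)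
      show "word_subst mul ((\<lambda>_. scl t u)(0 := v)) (Prod x y) = scl (- \<epsilon> * t ^ (n + k)) v" for t
        by (rule coords_eqI) (simp_all add: W vals k(2) coords power_add del: word_subst.simps fun_upd_apply)
      show "n + k = 0 \<and> - \<epsilon> = 1 \<or> n + k = 1 \<and> - \<epsilon> = -1 \<or> n + k \<ge> 2"
        using n k(1) by auto
    qed
  qed
  show ?case
  proof (cases "word_degree 0 x = 0")
    case True
    then have deg: "word_degree 0 y = 1" using Prod.prems by simp
    show ?thesis
    proof (rule step[where z = y and z' = x])
      show "word_subst mul ((\<lambda>_. scl t u)(0 := b)) (Prod x y)
          = mul (word_subst mul ((\<lambda>_. scl t u)(0 := b)) y) (word_subst mul (\<lambda>_. scl t u) x)" for b t
        by (simp add: True word_subst_fun_upd sym del: fun_upd_apply)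
    qed (rule Prod.IH(2)[OF deg])
  next
    case False
    then have deg: "word_degree 0 x = 1" "word_degree 0 y = 0" using Prod.prems by simp_all
    show ?thesis
    proof (rule step[where z = x and z' = y])
      show "word_subst mul ((\<lambda>_. scl t u)(0 := b)) (Prod x y)
          = mul (word_subst mul ((\<lambda>_. scl t u)(0 := b)) x) (word_subst mul (\<lambda>_. scl t u) y)" for b t
        by (simp add: deg word_subst_fun_upd del: fun_upd_apply)
    qed (rule Prod.IH(1)[OF deg(1)])
  qed
qed

lemma D2_operator_trace:
  assumes table: "mult_table scl u v mul 1 0 0 (-1) 0 (-1) 0 0" and h: "h \<in> operator_polynomials m"
  shows "\<exists>P. coeff P 1 = 0 \<and> (\<forall>t. operator_trace scl {u, v} mul h (\<lambda>_. scl t u) = poly P t)"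
proof -
  have "\<exists>P. coeff P 1 = 0 \<and> (\<forall>t. cu (monomial_subst mul ((\<lambda>_. scl t u)(0 := u)) w)
      + cv (monomial_subst mul ((\<lambda>_. scl t u)(0 := v)) w) = poly P t)"
    if w: "w \<in> Poly_Mapping.keys h" for w
  proof -
    obtain x where x: "w = Some x" "word_degree 0 x = 1"
      using operator_polynomials_keys[OF h w] by blast
    obtain n \<epsilon> where vals: "\<And>t. word_subst mul ((\<lambda>_. scl t u)(0 := u)) x = scl (t ^ n) u"
      "\<And>t. word_subst mul ((\<lambda>_. scl t u)(0 := v)) x = scl (\<epsilon> * t ^ n) v"
      and n: "n = 0 \<and> \<epsilon> = 1 \<or> n = 1 \<and> \<epsilon> = -1 \<or> n \<ge> 2"
      using D2_word[OF table x(2)] by blast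
    show ?thesis
      using n by (intro exI[of _ "monom (1 + \<epsilon>) n"])
        (auto simp: x monomial_subst_def vals poly_monom distrib_right simp del: fun_upd_apply)
  qed
  then obtain P where P: "\<And>w. w \<in> Poly_Mapping.keys h \<Longrightarrow> coeff (P w) 1 = 0"
    "\<And>w t. w \<in> Poly_Mapping.keys h \<Longrightarrow> cu (monomial_subst mul ((\<lambda>_. scl t u)(0 := u)) w)
      + cv (monomial_subst mul ((\<lambda>_. scl t u)(0 := v)) w) = poly (P w) t"
    by metis
  define Q where "Q = (\<Sum>w\<in>Poly_Mapping.keys h. smult (Poly_Mapping.lookup h w) (P w))"
  have "coeff Q 1 = 0" using P(1) by (simp add: Q_def coeff_sum)
  moreover have "operator_trace scl {u, v} mul h (\<lambda>_. scl t u) = poly Q t" for t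
    unfolding operator_trace_coords Q_def poly_sum poly_smult
    by (intro sum.cong refl) (simp only: P(2))
  ultimately show ?thesis by blast
qed

text \<open>
  Polynomials in \<open>t\<close> without linear term form an algebra.
\<close>

lemma D2_trace_algebra:
  assumes table: "mult_table scl u v mul 1 0 0 (-1) 0 (-1) 0 0"
    and F: "F \<in> trace_algebra scl {u, v} mul m"
  shows "\<exists>P. coeff P 1 = 0 \<and> (\<forall>t. F (\<lambda>_. scl t u) = poly P t)"
  using F unfolding trace_algebra_def
proof induction
  case one
  show ?case by (rule exI[of _ 1]) simp
next
  case (gen F)
  then show ?case using D2_operator_trace[OF table] by blast
next
  case (add F G)
  then obtain P Q where "coeff P 1 = 0" "coeff Q 1 = 0" "\<forall>t. F (\<lambda>_. scl t u) = poly P t"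
    "\<forall>t. G (\<lambda>_. scl t u) = poly Q t" by blast
  then show ?case by (intro exI[of _ "P + Q"]) simp
next
  case (scale F k)
  then obtain P where "coeff P 1 = 0" "\<forall>t. F (\<lambda>_. scl t u) = poly P t" by blast
  then show ?case by (intro exI[of _ "smult k P"]) simp
next
  case (mult F G)
  then obtain P Q where "coeff P 1 = 0" "coeff Q 1 = 0" "\<forall>t. F (\<lambda>_. scl t u) = poly P t"
    "\<forall>t. G (\<lambda>_. scl t u) = poly Q t" by blast
  then show ?case by (intro exI[of _ "P * Q"]) (simp add: coeff_mult)
qed

text \<open>
  The line of \<open>v\<close> consists of the vectors of square zero, and \<open>u v = -v\<close> fixes the scale of the
  \<open>u\<close>-coordinate.
\<close>

lemma D2_Aut:
  assumes table: "mult_table scl u v mul 1 0 0 (-1) 0 (-1) 0 0" and g: "g \<in> Aut scl mul"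
  shows "cu (g x) = cu x"
proof -
  note coords = mult_table_coords[OF table] and lin = linear_coords[OF AutD(1)[OF g]]
  have hom: "cu (g (mul x y)) = cu (mul (g x) (g y))" "cv (g (mul x y)) = cv (mul (g x) (g y))" for x y
    by (simp_all add: AutD(3)[OF g])
  have gv: "cu (g v) = 0" using hom(1)[of v v] by (simp add: lin[of "mul v v"] coords)
  have "cv (g v) \<noteq> 0"
  proof
    assume "cv (g v) = 0"
    with gv have "g v = g 0" by (intro coords_eqI) (simp_all add: lin[of 0])
    then show False using AutD(2)[OF g] coords_basis coords_zero by (metis injD zero_neq_one)
  qed
  moreover have "cv (g v) = cu (g u) * cv (g v)"
    using hom(2)[of u v] by (simp add: lin[of "mul u v"] coords gv)
  ultimately have "cu (g u) = 1" by simp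
  then show ?thesis by (simp add: lin[of x] gv)
qed

end

text \<open>
  The \<open>u\<close>-coordinate is invariant, but restricted to the points \<open>t u\<close> it is \<open>t\<close>, which is
  purely linear.
\<close>

lemma (in plane_algebra_char_0) inequality_D2:
  assumes table: "mult_table scl u v mul 1 0 0 (-1) 0 (-1) 0 0" and m: "m > 0"
  shows "invariants scl {u, v} mul m \<noteq> trace_algebra scl {u, v} mul m"
proof
  assume eq: "invariants scl {u, v} mul m = trace_algebra scl {u, v} mul m"
  define F where "F a = cu (a 1)" for a :: "nat \<Rightarrow> 'v"
  have "F \<in> polynomial_functions scl {u, v} m"
    using m unfolding F_def[abs_def] polynomial_functions_coords
    by (intro generated_subalgebra.gen) auto
  moreover have "F (\<lambda>r. g (a r)) = F a" if "g \<in> Aut scl mul" for g a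
    using D2_Aut[OF table that] by (simp add: F_def)
  ultimately have "F \<in> trace_algebra scl {u, v} mul m"
    unfolding eq[symmetric] by (simp add: invariants_def)
  then obtain P where P: "coeff P 1 = 0" "\<And>t. F (\<lambda>_. scl t u) = poly P t"
    using D2_trace_algebra[OF table] by blast
  then have "poly P = poly [:0, 1:]" by (simp add: F_def fun_eq_iff)
  then have "P = [:0, 1:]" by (simp only: poly_eq_poly_eq_iff)
  with P(1) show False by simp
qed


section \<open>Normal forms of plane algebras with a symmetry\<close>

locale plane_algebra_closed = plane_algebra_char_0 scl u v mul
  for scl :: "'a::{alg_closed_field, field_char_0} \<Rightarrow> 'v::ab_group_add \<Rightarrow> 'v" and u v :: 'v and mul

definition exceptional ::
  "('a::field \<Rightarrow> 'v::ab_group_add \<Rightarrow> 'v) \<Rightarrow> ('v \<Rightarrow> 'v \<Rightarrow> 'v) \<Rightarrow> nat \<Rightarrow> bool" where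
  "exceptional scl mul m \<longleftrightarrow>
     m > 1 \<and> (\<exists>\<alpha>. algebra_isomorphic scl mul (*s) (A1_mult \<alpha>)) \<or>
     m > 1 \<and> algebra_isomorphic scl mul (*s) A2_mult \<or>
     algebra_isomorphic scl mul (*s) D2_mult"

text \<open>
  The outcome of every case of the classification. As it does not depend on the basis, each
  case may pass to the basis that suits it.
\<close>

definition equality_or_exceptional ::
  "('a::field \<Rightarrow> 'v::ab_group_add \<Rightarrow> 'v) \<Rightarrow> 'v set \<Rightarrow> ('v \<Rightarrow> 'v \<Rightarrow> 'v) \<Rightarrow> nat \<Rightarrow> bool" where
  "equality_or_exceptional scl B mul m \<longleftrightarrow>
     invariants scl B mul m = trace_algebra scl B mul m \<or> exceptional scl mul m"

context plane_algebra_closed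
begin

lemma closed_frame:
  assumes "cu u' * cv v' - cv u' * cu v' \<noteq> 0"
  shows "plane_algebra_closed scl u' v' mul"
  using change_frame[OF assms]
  by (simp add: plane_algebra_closed_def plane_algebra_char_0_def)

lemma equality_or_exceptional_frame:
  assumes "plane_algebra_closed scl u' v' mul" "equality_or_exceptional scl {u', v'} mul m"
  shows "equality_or_exceptional scl {u, v} mul m"
proof -
  interpret p: plane_algebra_closed scl u' v' mul by fact
  show ?thesis
    using frame_independent[OF p.plane_algebra_axioms] assms(2)
    by (simp add: equality_or_exceptional_def)
qed

lemma swapped_frame: "plane_algebra_closed scl v u mul"
  by (rule closed_frame) simp

lemma swapped_table:
  "mult_table scl v u mul d' d c' c b' b a' a" if "mult_table scl u v mul a a' b b' c c' d d'"
  using that by (simp add: mult_table_def add.commute)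

lemma D2_I: "mult_table scl u v mul 1 0 0 (-1) 0 (-1) 0 0 \<Longrightarrow> equality_or_exceptional scl {u, v} mul m"
  unfolding equality_or_exceptional_def exceptional_def D2_mult_def
  using algebra_isomorphic_table_mult[of e1 "- e2" "- e2" 0] by (simp add: axis_def)

lemma A1_I:
  "mult_table scl u v mul 1 1 0 \<alpha> 0 (1 - \<alpha>) 0 0 \<Longrightarrow> m > 1 \<Longrightarrow> equality_or_exceptional scl {u, v} mul m"
  unfolding equality_or_exceptional_def exceptional_def A1_mult_def
  using algebra_isomorphic_table_mult[of "e1 + e2" "\<alpha> *s e2" "(1 - \<alpha>) *s e2" 0]
  by (auto simp: axis_def)

lemma A2_I:
  "mult_table scl u v mul 0 1 0 1 0 (-1) 0 0 \<Longrightarrow> m > 1 \<Longrightarrow> equality_or_exceptional scl {u, v} mul m"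
  unfolding equality_or_exceptional_def exceptional_def A2_mult_def
  using algebra_isomorphic_table_mult[of e2 e2 "- e2" 0] by (simp add: axis_def)

text \<open>
  If neither trace sees the \<open>u\<close>-coordinate, then the algebra is zero or \<open>D\<^sub>2(-1, -1)\<close>.
\<close>

lemma torus_case:
  assumes table: "mult_table scl u v mul a 0 0 b 0 c 0 0"
  shows "equality_or_exceptional scl {u, v} mul m"
proof -
  consider "a + b \<noteq> 0 \<or> a + c \<noteq> 0" | "b = - a" "c = - a" "a = 0" | "b = - a" "c = - a" "a \<noteq> 0"
    by (metis add_eq_0_iff)
  then show ?thesis
  proof cases
    case 1
    then show ?thesis using equality_torus[OF table] by (simp add: equality_or_exceptional_def)
  next
    case 2
    then show ?thesis using table equality_square[of 0] by (simp add: equality_or_exceptional_def)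
  next
    case 3
    let ?u = "scl (1 / a) u"
    have frame: "plane_algebra_closed scl ?u v mul" by (rule closed_frame) (use 3 in simp)
    moreover have "mult_table scl ?u v mul 1 0 0 (-1) 0 (-1) 0 0"
      unfolding mult_table_def using 3 by (auto intro!: coords_eqI simp: mult_table_coords[OF table])
    ultimately show ?thesis
      using plane_algebra_closed.D2_I equality_or_exceptional_frame by blast
  qed
qed

lemma primitive_cube_root: "\<exists>\<omega>::'a. \<omega>\<^sup>2 + \<omega> + 1 = 0"
proof -
  obtain \<omega> :: 'a where "poly [:1, 1, 1:] \<omega> = 0"
    using alg_closed_imp_poly_has_root[of "[:1, 1, 1:]"] by auto
  then show ?thesis by (intro exI[of _ \<omega>]) (simp add: algebra_simps power2_eq_square)
qed

lemma S3_I: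
  assumes "mult_table scl u v mul 0 1 0 0 0 0 1 0"
  shows "equality_or_exceptional scl {u, v} mul m"
proof -
  interpret S3_algebra scl u v mul m by unfold_locales fact
  show ?thesis
    using primitive_cube_root equality_S3 by (auto simp: equality_or_exceptional_def)
qed

text \<open>
  If neither trace sees the \<open>u\<close>-coordinate and \<open>a\<close>, \<open>d\<close> are nonzero, then after scaling
  \<open>u u = u\<close>, \<open>u v = v u = -v\<close>, \<open>v v = u\<close>. The halves of \<open>u + v\<close> and \<open>u - v\<close> are each other's
  squares and annihilate each other.
\<close>

lemma reflection_case:
  assumes table: "mult_table scl u v mul a 0 0 b 0 c d 0"
  shows "equality_or_exceptional scl {u, v} mul m"
proof -
  note coords = mult_table_coords[OF table]
  consider "d = 0" | "d \<noteq> 0" "a + b \<noteq> 0 \<or> a + c \<noteq> 0" | "b = - a" "c = - a" "a = 0"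
    | "d \<noteq> 0" "b = - a" "c = - a" "a \<noteq> 0"
    by (metis add_eq_0_iff)
  then show ?thesis
  proof cases
    case 1
    then show ?thesis using table torus_case by simp
  next
    case 2
    then show ?thesis using equality_reflection[OF table] by (simp add: equality_or_exceptional_def)
  next
    case 3
    interpret s: plane_algebra_closed scl v u mul by (rule swapped_frame)
    have "mult_table scl v u mul 0 d 0 0 0 0 0 0"
      using swapped_table[OF table] 3 by simp
    then show ?thesis
      using s.equality_square equality_or_exceptional_frame[OF swapped_frame]
      by (simp add: equality_or_exceptional_def)
  next
    case 4
    \<comment> \<open>Scaling \<open>v\<close> by \<open>s\<close> and \<open>u\<close> by \<open>1 / a\<close> gives the normalised table.\<close>
    obtain s where "poly [:- 1 / (d * a), 0, 1:] s = 0"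
      using alg_closed_imp_poly_has_root[of "[:- 1 / (d * a), 0, 1:]"] by auto
    then have s: "s * s * d * a = 1" using 4 by (simp add: field_simps)
    then have "s \<noteq> 0" by auto
    define p q where "p = scl (1 / (2 * a)) u + scl (s / 2) v" and "q = scl (1 / (2 * a)) u + scl (- s / 2) v"
    have pq: "cu p = 1 / (2 * a)" "cv p = s / 2" "cu q = 1 / (2 * a)" "cv q = - s / 2"
      by (simp_all add: p_def q_def)
    have frame: "plane_algebra_closed scl p q mul"
      by (rule closed_frame) (use \<open>s \<noteq> 0\<close> 4 in \<open>simp add: pq field_simps\<close>)
    have "mult_table scl p q mul 0 1 0 0 0 0 1 0"
      unfolding mult_table_def
    by (intro conjI coords_eqI) (use 4 s in \<open>simp_all add: coords pq field_simps\<close>)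
    then show ?thesis
      using plane_algebra_closed.S3_I[OF frame] equality_or_exceptional_frame[OF frame] by blast
  qed
qed

text \<open>
  Rescaling \<open>u\<close> by \<open>x\<close> and \<open>v\<close> by \<open>x\<^sup>2 p\<close> normalises \<open>p\<close> to one, and \<open>q\<close> too if
  \<open>x\<^sup>3 p\<^sup>2 q = 1\<close>.
\<close>

lemma cross_case:
  assumes table: "mult_table scl u v mul 0 p 0 0 0 0 q 0"
  shows "equality_or_exceptional scl {u, v} mul m"
proof -
  note coords = mult_table_coords[OF table]
  consider "q = 0" | "p = 0" | "p \<noteq> 0" "q \<noteq> 0" by blast
  then show ?thesis
  proof cases
    case 1
    then show ?thesis using table equality_square by (simp add: equality_or_exceptional_def)
  next
    case 2
    then show ?thesis using table reflection_case[of 0 0 0] by simp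
  next
    case 3
    obtain x where "poly [:- 1 / (p * p * q), 0, 0, 1:] x = 0"
      using alg_closed_imp_poly_has_root[of "[:- 1 / (p * p * q), 0, 0, 1:]"] by auto
    then have x: "x * x * x * p * p * q = 1" using 3 by (simp add: field_simps)
    then have "x \<noteq> 0" by auto
    let ?u = "scl x u" and ?v = "scl (x * x * p) v"
    have frame: "plane_algebra_closed scl ?u ?v mul"
      by (rule closed_frame) (use \<open>x \<noteq> 0\<close> 3 in simp)
    have "x * x * p * (x * x * p) * q = x"
      using x by (metis mult.assoc mult.commute mult.left_neutral)
    then have "mult_table scl ?u ?v mul 0 1 0 0 0 0 1 0"
      unfolding mult_table_def by (auto intro!: coords_eqI simp: coords mult_ac)
    then show ?thesis
      using plane_algebra_closed.S3_I[OF frame] equality_or_exceptional_frame[OF frame] by blast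
  qed
qed

lemma shear_case:
  assumes table: "mult_table scl u v mul (b + c) k 0 b 0 c 0 0" and m: "m > 0"
  shows "equality_or_exceptional scl {u, v} mul m"
proof -
  note coords = mult_table_coords[OF table]
  consider "k = 0" | "b = 0" "c = 0" | "b \<noteq> 0 \<or> c \<noteq> 0" "m = 1" | "k \<noteq> 0" "b + c \<noteq> 0" "m > 1"
    | "k \<noteq> 0" "b \<noteq> 0" "c = - b" "m > 1"
    using m by (metis add_eq_0_iff add.right_neutral less_one linorder_neqE_nat not_less_zero minus_zero)
  then show ?thesis
  proof cases
    case 1
    then show ?thesis using table torus_case by simp
  next
    case 2
    then show ?thesis using table equality_square by (simp add: equality_or_exceptional_def)
  next
    case 3
    then show ?thesis using equality_shear[OF table] by (simp add: equality_or_exceptional_def)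
  next
    case 4
    let ?u = "scl (1 / (b + c)) u" and ?v = "scl (k / (b + c)\<^sup>2) v"
    have frame: "plane_algebra_closed scl ?u ?v mul" by (rule closed_frame) (use 4 in simp)
    have "1 - b / (b + c) = c / (b + c)" using 4 by (simp add: field_simps)
    then have "mult_table scl ?u ?v mul 1 1 0 (b / (b + c)) 0 (1 - b / (b + c)) 0 0"
      unfolding mult_table_def using 4
      by (auto intro!: coords_eqI simp: coords power2_eq_square)
    then show ?thesis
      using plane_algebra_closed.A1_I[OF frame] equality_or_exceptional_frame[OF frame] 4 by blast
  next
    case 5
    let ?u = "scl (1 / b) u" and ?v = "scl (k / b\<^sup>2) v"
    have frame: "plane_algebra_closed scl ?u ?v mul" by (rule closed_frame) (use 5 in simp)
    have "mult_table scl ?u ?v mul 0 1 0 1 0 (-1) 0 0"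
      unfolding mult_table_def using 5
      by (auto intro!: coords_eqI simp: coords power2_eq_square)
    then show ?thesis
      using plane_algebra_closed.A2_I[OF frame] equality_or_exceptional_frame[OF frame] 5 by blast
  qed
qed

lemma Aut_scale_nonzero:
  assumes "g \<in> Aut scl mul" "g x = scl k x" "x \<noteq> 0"
  shows "k \<noteq> 0"
proof
  assume "k = 0"
  then have "g x = g 0" using assms linear_coords[OF AutD(1)[OF assms(1)], of 0]
    by (intro coords_eqI) simp_all
  then show False using AutD(2)[OF assms(1)] assms(3) by (auto dest: injD)
qed

text \<open>
  A structure constant can be nonzero only if the weights of the eigenvectors \<open>u\<close>, \<open>v\<close> match.
  The matching conditions leave the tables of the previous cases.
\<close>

lemma diagonal_case:
  assumes g: "g \<in> Aut scl mul" and gu: "g u = scl \<nu> u" and gv: "g v = scl \<mu> v"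
    and "\<nu> \<noteq> 1 \<or> \<mu> \<noteq> 1"
  shows "equality_or_exceptional scl {u, v} mul m"
proof -
  obtain a a' b b' c c' d d' where table: "mult_table scl u v mul a a' b b' c c' d d'"
    using mult_table_exists by blast
  note coords = mult_table_coords[OF table] and lin = linear_coords[OF AutD(1)[OF g]]
  have nonzero: "\<nu> \<noteq> 0" "\<mu> \<noteq> 0"
    using Aut_scale_nonzero[OF g gu] Aut_scale_nonzero[OF g gv] by (metis coords_basis coords_zero zero_neq_one)+
  have hom: "cu (g (mul x y)) = cu (mul (g x) (g y))" "cv (g (mul x y)) = cv (mul (g x) (g y))" for x y
    by (simp_all add: AutD(3)[OF g])
  note eqs = hom[of u u] hom[of u v] hom[of v u] hom[of v v]
  have weights: "(\<nu> - 1) * a = 0" "(\<nu>\<^sup>2 - \<mu>) * a' = 0" "(\<mu> - 1) * b = 0" "(\<nu> - 1) * b' = 0"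
    "(\<mu> - 1) * c = 0" "(\<nu> - 1) * c' = 0" "(\<mu>\<^sup>2 - \<nu>) * d = 0" "(\<mu> - 1) * d' = 0"
    using eqs nonzero by (auto simp: lin[of "mul x y" for x y] coords gu gv power2_eq_square algebra_simps)
  consider "\<nu> = 1" "\<mu> \<noteq> 1" | "\<nu> \<noteq> 1" "\<mu> = 1" | "\<nu> \<noteq> 1" "\<mu> \<noteq> 1" using assms(4) by blast
  then show ?thesis
  proof cases
    case 1
    then have "a' = 0" "b = 0" "c = 0" "d' = 0" using weights by auto
    then show ?thesis using table reflection_case by simp
  next
    case 2
    then have "d = 0" "b' = 0" "c' = 0" "a = 0" using weights by auto
    then have "mult_table scl v u mul d' 0 0 c 0 b a' 0" using swapped_table[OF table] by simp
    then show ?thesis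
      using plane_algebra_closed.reflection_case[OF swapped_frame]
        equality_or_exceptional_frame[OF swapped_frame] by blast
  next
    case 3
    then have "a = 0" "b = 0" "c = 0" "b' = 0" "c' = 0" "d' = 0" using weights by auto
    then show ?thesis using table cross_case by simp
  qed
qed

text \<open>
  The only eigenvalue of \<open>g\<close> is \<open>\<nu>\<close>, but it acts on products with eigenvalue \<open>\<nu>\<^sup>2\<close>, so
  for \<open>\<nu> \<noteq> 1\<close> all products vanish; a unipotent Jordan block leaves the shear tables.
\<close>

lemma jordan_case:
  assumes g: "g \<in> Aut scl mul" and gu: "g u = scl \<nu> u + v" and gv: "g v = scl \<nu> v" and m: "m > 0"
  shows "equality_or_exceptional scl {u, v} mul m"
proof -
  obtain a a' b b' c c' d d' where table: "mult_table scl u v mul a a' b b' c c' d d'"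
    using mult_table_exists by blast
  note coords = mult_table_coords[OF table] and lin = linear_coords[OF AutD(1)[OF g]]
  have nonzero: "\<nu> \<noteq> 0"
    using Aut_scale_nonzero[OF g gv] by (metis coords_basis(4) coords_zero(2) zero_neq_one)
  have hom: "cu (g (mul x y)) = cu (mul (g x) (g y))" "cv (g (mul x y)) = cv (mul (g x) (g y))" for x y
    by (simp_all add: AutD(3)[OF g])
  have eqs: "\<nu> * a = \<nu>\<^sup>2 * a + \<nu> * b + \<nu> * c + d" "a + \<nu> * a' = \<nu>\<^sup>2 * a' + \<nu> * b' + \<nu> * c' + d'"
    "\<nu> * b = \<nu>\<^sup>2 * b + \<nu> * d" "b + \<nu> * b' = \<nu>\<^sup>2 * b' + \<nu> * d'"
    "\<nu> * c = \<nu>\<^sup>2 * c + \<nu> * d" "c + \<nu> * c' = \<nu>\<^sup>2 * c' + \<nu> * d'"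
    "\<nu> * d = \<nu>\<^sup>2 * d" "d + \<nu> * d' = \<nu>\<^sup>2 * d'"
    using hom[of u u] hom[of u v] hom[of v u] hom[of v v]
    by (simp_all add: lin[of "mul x y" for x y] coords gu gv power2_eq_square algebra_simps)
  show ?thesis
  proof (cases "\<nu> = 1")
    case True
    with eqs have d: "d = 0" and bc: "b = d'" "c = d'" and "b + c = 0" "a = b' + c'"
      by (simp_all add: algebra_simps)
    then have "2 * d' = 0" by simp
    then have "d' = 0" by simp
    with d bc \<open>a = b' + c'\<close> have "mult_table scl u v mul (b' + c') a' 0 b' 0 c' 0 0"
      using table by simp
    then show ?thesis using m by (rule shear_case)
  next
    case False
    then have L: "\<nu> \<noteq> \<nu>\<^sup>2" using nonzero by (auto simp: power2_eq_square)
    have "d = 0" using eqs(7) by (simp add: L)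
    moreover from this have "b = 0" "c = 0" "d' = 0" using eqs(3,5,8) by (simp_all add: L)
    moreover from calculation have "a = 0" "b' = 0" "c' = 0" using eqs(1,4,6) by (simp_all add: L)
    moreover from calculation have "a' = 0" using eqs(2) by (simp add: L)
    ultimately show ?thesis using table torus_case[of 0 0 0] by simp
  qed
qed

text \<open>
  The Jordan form of \<open>g\<close>, starting from an eigenvector \<open>v\<close>.
\<close>

lemma triangular_case:
  assumes g: "g \<in> Aut scl mul" "g \<noteq> id" and gv: "g v = scl \<mu> v" and m: "m > 0"
  shows "equality_or_exceptional scl {u, v} mul m"
proof -
  note lin = linear_coords[OF AutD(1)[OF g(1)]]
  define \<nu> \<kappa> where "\<nu> = cu (g u)" and "\<kappa> = cv (g u)"
  note lk = \<nu>_def[symmetric] \<kappa>_def[symmetric]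
  consider "\<nu> \<noteq> \<mu>" | "\<nu> = \<mu>" "\<kappa> = 0" | "\<nu> = \<mu>" "\<kappa> \<noteq> 0" by blast
  then show ?thesis
  proof cases
    case 1
    let ?u = "u + scl (\<kappa> / (\<nu> - \<mu>)) v"
    have frame: "plane_algebra_closed scl ?u v mul" by (rule closed_frame) simp
    have "g ?u = scl \<nu> ?u"
      using 1 by (intro coords_eqI) (simp_all add: lin[of ?u] lk gv field_simps)
    then show ?thesis
      using plane_algebra_closed.diagonal_case[OF frame g(1) _ gv]
        equality_or_exceptional_frame[OF frame] 1 by metis
  next
    case 2
    have gu: "g u = scl \<nu> u" using 2 by (intro coords_eqI) (simp_all add: lk)
    have "\<not> (\<nu> = 1 \<and> \<mu> = 1)"
    proof
      assume "\<nu> = 1 \<and> \<mu> = 1"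
      then have "g x = id x" for x by (intro coords_eqI) (simp_all add: lin[of x] gu gv)
      then show False using g(2) by blast
    qed
    then show ?thesis using diagonal_case[OF g(1) gu gv] by blast
  next
    case 3
    let ?v = "scl \<kappa> v"
    have frame: "plane_algebra_closed scl u ?v mul" by (rule closed_frame) (use 3 in simp)
    have "g u = scl \<nu> u + ?v" "g ?v = scl \<nu> ?v"
      using 3 by (auto intro!: coords_eqI simp: lin[of ?v] lk gv)
    then show ?thesis
      using plane_algebra_closed.jordan_case[OF frame g(1) _ _ m]
        equality_or_exceptional_frame[OF frame] by blast
  qed
qed

lemma nontrivial_automorphism:
  assumes g: "g \<in> Aut scl mul" "g \<noteq> id" and m: "m > 0"
  shows "equality_or_exceptional scl {u, v} mul m"
proof -
  note lin = linear_coords[OF AutD(1)[OF g(1)]]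
  define p q r s where "p = cu (g u)" and "q = cv (g u)" and "r = cu (g v)" and "s = cv (g v)"
  note pqrs = p_def[symmetric] q_def[symmetric] r_def[symmetric] s_def[symmetric]
  show ?thesis
  proof (cases "q = 0")
    case True
    then have "g u = scl p u" by (intro coords_eqI) (simp_all add: pqrs)
    then show ?thesis
      using plane_algebra_closed.triangular_case[OF swapped_frame g _ m]
        equality_or_exceptional_frame[OF swapped_frame] by blast
  next
    case False
    \<comment> \<open>A root of the characteristic polynomial, and the eigenvector of \<open>g\<close> belonging to it.\<close>
    obtain \<mu> where "poly [:p * s - q * r, - (p + s), 1:] \<mu> = 0"
      using alg_closed_imp_poly_has_root[of "[:p * s - q * r, - (p + s), 1:]"] by auto
    then have \<mu>: "\<mu> * \<mu> = (p + s) * \<mu> - (p * s - q * r)" by (simp add: algebra_simps)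
    define w where "w = scl (\<mu> - s) u + scl q v"
    have w: "cu w = \<mu> - s" "cv w = q" by (simp_all add: w_def)
    have frame: "plane_algebra_closed scl u w mul" by (rule closed_frame) (use False in \<open>simp add: w\<close>)
    have "g w = scl \<mu> w"
      using \<mu> by (intro coords_eqI) (simp_all add: lin[of w] w pqrs algebra_simps)
    then show ?thesis
      using plane_algebra_closed.triangular_case[OF frame g _ m]
        equality_or_exceptional_frame[OF frame] by blast
  qed
qed

end

section \<open>Failure for the exceptional algebras\<close>

lemma inequality_if_exceptional:
  fixes scl :: "'a::field_char_0 \<Rightarrow> 'v::ab_group_add \<Rightarrow> 'v"
  assumes "nonassoc_algebra scl B mul" "card B = 2" "m > 0" "exceptional scl mul m"
  shows "invariants scl B mul m \<noteq> trace_algebra scl B mul m"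
proof -
  interpret nonassoc_algebra scl B mul by fact
  have transfer: "invariants scl B mul m \<noteq> trace_algebra scl B mul m"
    if frame: "plane_algebra scl u v mul"
      and neq: "invariants scl {u, v} mul m \<noteq> trace_algebra scl {u, v} mul m" for u v
  proof -
    interpret p: plane_algebra scl u v mul by (rule frame)
    show ?thesis
      using neq invariants_basis[OF p.finite_dimensional_vector_space_axioms]
        trace_algebra_basis[OF p.finite_dimensional_vector_space_axioms] by simp
  qed
  consider \<alpha> where "m > 1" "algebra_isomorphic scl mul (*s) (A1_mult \<alpha>)"
    | "m > 1" "algebra_isomorphic scl mul (*s) A2_mult"
    | "algebra_isomorphic scl mul (*s) D2_mult"
    using assms(4) unfolding exceptional_def by blast
  then show ?thesis
  proof cases
    case 1
    then obtain u v where frame: "plane_algebra scl u v mul"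
      and "mult_table scl u v mul 1 1 0 \<alpha> 0 (1 - \<alpha>) 0 0"
      using table_of_algebra_isomorphic[OF assms(2)] unfolding A1_mult_def
      by (fastforce simp: axis_def)
    then have "mult_table scl u v mul (\<alpha> + (1 - \<alpha>)) 1 0 \<alpha> 0 (1 - \<alpha>) 0 0" by simp
    then have "invariants scl {u, v} mul m \<noteq> trace_algebra scl {u, v} mul m"
      by (rule plane_algebra.inequality_shear[OF frame]) (use 1 in auto)
    then show ?thesis by (rule transfer[OF frame])
  next
    case 2
    then obtain u v where frame: "plane_algebra scl u v mul"
      and "mult_table scl u v mul 0 1 0 1 0 (- 1) 0 0"
      using table_of_algebra_isomorphic[OF assms(2)] unfolding A2_mult_def
      by (fastforce simp: axis_def)
    then have "mult_table scl u v mul (1 + - 1) 1 0 1 0 (- 1) 0 0" by simp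
    then have "invariants scl {u, v} mul m \<noteq> trace_algebra scl {u, v} mul m"
      by (rule plane_algebra.inequality_shear[OF frame]) (use 2 in auto)
    then show ?thesis by (rule transfer[OF frame])
  next
    case 3
    then obtain u v where frame: "plane_algebra scl u v mul"
      and table: "mult_table scl u v mul 1 0 0 (- 1) 0 (- 1) 0 0"
      using table_of_algebra_isomorphic[OF assms(2)] unfolding D2_mult_def
      by (fastforce simp: axis_def)
    then interpret p: plane_algebra_char_0 scl u v mul by (simp add: plane_algebra_char_0_def)
    show ?thesis by (rule transfer[OF frame p.inequality_D2[OF table assms(3)]])
  qed
qed

theorem theorem7p8:
  fixes scl :: "'a::{alg_closed_field, field_char_0} \<Rightarrow> 'v::ab_group_add \<Rightarrow> 'v"
    and B :: "'v set"
    and mul :: "'v \<Rightarrow> 'v \<Rightarrow> 'v"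
    and m :: nat
  assumes "nonassoc_algebra scl B mul"
    and "card B = 2"
    and "Aut scl mul \<noteq> {id}"
    and "m > 0"
  shows "invariants scl B mul m = trace_algebra scl B mul m \<longleftrightarrow>
    \<not> (m > 1 \<and> (\<exists>\<alpha>. algebra_isomorphic scl mul (*s) (A1_mult \<alpha>))) \<and>
    \<not> (m > 1 \<and> algebra_isomorphic scl mul (*s) A2_mult) \<and>
    \<not> algebra_isomorphic scl mul (*s) D2_mult"
proof -
  obtain u v where frame: "plane_algebra scl u v mul" and B: "B = {u, v}"
    using nonassoc_algebra.plane_algebra_exists[OF assms(1,2)] by blast
  then interpret plane_algebra_closed scl u v mul
    by (simp add: plane_algebra_closed_def plane_algebra_char_0_def)
  have "id \<in> Aut scl mul"
    by (simp add: Aut_def algebra_iso_def linear_selfI)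
  then obtain g where "g \<in> Aut scl mul" "g \<noteq> id" using assms(3) by blast
  then have "equality_or_exceptional scl B mul m"
    unfolding B using assms(4) by (rule nontrivial_automorphism)
  then have "invariants scl B mul m = trace_algebra scl B mul m \<longleftrightarrow> \<not> exceptional scl mul m"
    using inequality_if_exceptional[OF assms(1,2,4)] by (auto simp: equality_or_exceptional_def)
  then show ?thesis by (auto simp: exceptional_def)
qed

end
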